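(* Let $k=k(n)$ be any integer-valued function such that $k(n)\le n/(4\log n)$. Then $\mathrm{ERPHP}^k_{n,k-1}$ can be refuted in PCR in size $O(k^{k+1}n^k)$, and any PCR refutation of it requires size $\Omega\!\left(\dfrac{n^{\lceil (k-1)/2\rceil}}{(4k\log n)^k}\right)$.
   Context: $\log$ is the binary logarithm; $[n]=\{1,\dots,n\}$, $[a,b]=\{a,\dots,b\}$. The 3-CNF formula $\mathrm{ERPHP}^k_{n,k-1}$ has variables $p_{u,v}$ ($u\in[k],v\in[n]$), $y_{u,v}$ ($u\in[k]$, $v\in[2,n-2]$), $r_v$ ($v\in[n]$), $r_{v,v'}$ ($v\ne v'\in[n]$), $q_{v,w}$ ($v\in[n],w\in[k-1]$), $z_{v,w}$ ($v\in[n]$, $w\in[k-3]$), and clauses: $p_{u,1}\lor p_{u,2}\lor y_{u,2}$ ($u\in[k]$); $\bar y_{u,v}\lor p_{u,v+1}\lor y_{u,v+1}$ ($u\in[k],v\in[2,n-3]$); $\bar y_{u,n-2}\lor p_{u,n-1}\lor p_{u,n}$ ($u\in[k]$); $\bar r_v\lor q_{v,1}\lor z_{v,1}$ ($v\in[n]$); $\bar z_{v,w}\lor q_{v,w+1}\lor z_{v,w+1}$ ($v\in[n],w\in[k-4]$); $\bar z_{v,k-3}\lor q_{v,k-2}\lor q_{v,k-1}$ ($v\in[n]$); $\bar p_{u,v}\lor\bar p_{u',v}$ ($u\ne u'\in[k],v\in[n]$); $\bar p_{u,v}\lor r_v$ ($u\in[k],v\in[n]$); $\bar r_v\lor\bar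 r_{v'}\lor r_{v,v'}$ ($v\ne v'\in[n]$); $\bar r_{v,v'}\lor\bar q_{v,w}\lor\bar q_{v',w}$ ($v\ne v'\in[n],w\in[k-1]$). PCR over a fixed field $\mathbb F$: polynomials over the variables and formally independent twins $\bar x$; true is $0$, false is $1$; a clause $\bigvee_{i\in I}x_i\lor\bigvee_{j\in J}\bar x_j$ becomes $\prod_{i\in I}x_i\prod_{j\in J}\bar x_j$. A PCR refutation is a sequence of polynomials ending in $1$, each being a Boolean axiom $x^2-x$ (any variable or twin), a complementarity axiom $1-x-\bar x$, a translated clause, a linear combination $\alpha p_i+\beta p_j$ ($\alpha,\beta\in\mathbb F$) of earlier polynomials, or $xp_i$ for an earlier $p_i$ and variable $x$. Its size is the total number of terms (monomials with nonzero coefficient) over all its polynomials. *)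

theory Defs
  imports Complex_Main "HOL-Library.Poly_Mapping"
begin

datatype 'v literal = Pos 'v | Neg 'v

type_synonym 'v clause = "'v literal set"

text \<open>
  The ring has one formal variable per literal: \<open>Pos x\<close> plays the role of \<open>x\<close> and \<open>Neg x\<close> that of
  its formally independent twin. Inner mappings are exponent vectors, outer ones list coefficients.
\<close>

type_synonym ('v, 'a) pcr_poly = "('v literal \<Rightarrow>\<^sub>0 nat) \<Rightarrow>\<^sub>0 'a"

definition literals_over :: "'v set \<Rightarrow> 'v literal set" where
  "literals_over V = Pos ` V \<union> Neg ` V"

definition lit_poly :: "'v literal \<Rightarrow> ('v, 'a::field) pcr_poly" where
  "lit_poly l = Poly_Mapping.single (Poly_Mapping.single l 1) 1"

definition const_poly :: "'a \<Rightarrow> ('v, 'a::field) pcr_poly" where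
  "const_poly a = Poly_Mapping.single 0 a"

text \<open>Since true is encoded by 0, a clause is satisfied iff the product of its literals is 0.\<close>

definition clause_poly :: "'v clause \<Rightarrow> ('v, 'a::field) pcr_poly" where
  "clause_poly C = (\<Prod>l\<in>C. lit_poly l)"

definition num_terms :: "('v, 'a::field) pcr_poly \<Rightarrow> nat" where
  "num_terms p = card (Poly_Mapping.keys p)"

text \<open>
  \<open>V\<close> is the set of variables, \<open>F\<close> the CNF formula and \<open>E\<close> the set of earlier lines.
  Multiplication is allowed by every variable of the ring, twins included.
\<close>

definition pcr_inference ::
    "'v set \<Rightarrow> 'v clause set \<Rightarrow> ('v, 'a::field) pcr_poly set \<Rightarrow> ('v, 'a) pcr_poly \<Rightarrow> bool" where
  "pcr_inference V F E p \<longleftrightarrow>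
     (\<exists>l\<in>literals_over V. p = lit_poly l ^ 2 - lit_poly l) \<or>
     (\<exists>x\<in>V. p = 1 - lit_poly (Pos x) - lit_poly (Neg x)) \<or>
     (\<exists>C\<in>F. p = clause_poly C) \<or>
     (\<exists>q\<in>E. \<exists>q'\<in>E. \<exists>\<alpha> \<beta>. p = const_poly \<alpha> * q + const_poly \<beta> * q') \<or>
     (\<exists>q\<in>E. \<exists>l\<in>literals_over V. p = lit_poly l * q)"

definition pcr_refutation ::
    "'v set \<Rightarrow> 'v clause set \<Rightarrow> ('v, 'a::field) pcr_poly list \<Rightarrow> bool" where
  "pcr_refutation V F \<pi> \<longleftrightarrow>
     \<pi> \<noteq> [] \<and> last \<pi> = 1 \<and> (\<forall>i<length \<pi>. pcr_inference V F (set (take i \<pi>)) (\<pi> ! i))"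

definition pcr_size :: "('v, 'a::field) pcr_poly list \<Rightarrow> nat" where
  "pcr_size \<pi> = (\<Sum>p\<leftarrow>\<pi>. num_terms p)"

text \<open>\<open>R v\<close> is \<open>r\<^sub>v\<close> and \<open>RR v v'\<close> is the doubly indexed variable, for ordered pairs \<open>v \<noteq> v'\<close>.\<close>

datatype erphp_var =
  P nat nat | Y nat nat | R nat | RR nat nat | Q nat nat | Z nat nat

text \<open>
  The formula with \<open>k\<close> pigeons, \<open>n\<close> intermediate places and \<open>k - 1\<close> holes. The index ranges and the
  literals \<open>Z v 1\<close>, \<open>Z v (k - 3)\<close>, \<open>Y u 2\<close>, \<open>Y u (n - 2)\<close> presuppose \<open>k \<ge> 4\<close> and \<open>n \<ge> 4\<close>; for
  smaller arguments (where subtraction truncates) the definitions below carry no meaning.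
\<close>

definition erphp_vars :: "nat \<Rightarrow> nat \<Rightarrow> erphp_var set" where
  "erphp_vars k n =
     {P u v | u v. u \<in> {1..k} \<and> v \<in> {1..n}} \<union>
     {Y u v | u v. u \<in> {1..k} \<and> v \<in> {2..n-2}} \<union>
     {R v | v. v \<in> {1..n}} \<union>
     {RR v v' | v v'. v \<in> {1..n} \<and> v' \<in> {1..n} \<and> v \<noteq> v'} \<union>
     {Q v w | v w. v \<in> {1..n} \<and> w \<in> {1..k-1}} \<union>
     {Z v w | v w. v \<in> {1..n} \<and> w \<in> {1..k-3}}"

definition erphp :: "nat \<Rightarrow> nat \<Rightarrow> erphp_var clause set" where
  "erphp k n =
     {{Pos (P u 1), Pos (P u 2), Pos (Y u 2)} | u. u \<in> {1..k}} \<union>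
     {{Neg (Y u v), Pos (P u (v+1)), Pos (Y u (v+1))} | u v. u \<in> {1..k} \<and> v \<in> {2..n-3}} \<union>
     {{Neg (Y u (n-2)), Pos (P u (n-1)), Pos (P u n)} | u. u \<in> {1..k}} \<union>
     {{Neg (R v), Pos (Q v 1), Pos (Z v 1)} | v. v \<in> {1..n}} \<union>
     {{Neg (Z v w), Pos (Q v (w+1)), Pos (Z v (w+1))} | v w. v \<in> {1..n} \<and> w \<in> {1..k-4}} \<union>
     {{Neg (Z v (k-3)), Pos (Q v (k-2)), Pos (Q v (k-1))} | v. v \<in> {1..n}} \<union>
     {{Neg (P u v), Neg (P u' v)} | u u' v.
        u \<in> {1..k} \<and> u' \<in> {1..k} \<and> u \<noteq> u' \<and> v \<in> {1..n}} \<union>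
     {{Neg (P u v), Pos (R v)} | u v. u \<in> {1..k} \<and> v \<in> {1..n}} \<union>
     {{Neg (R v), Neg (R v'), Pos (RR v v')} | v v'.
        v \<in> {1..n} \<and> v' \<in> {1..n} \<and> v \<noteq> v'} \<union>
     {{Neg (RR v v'), Neg (Q v w), Neg (Q v' w)} | v v' w.
        v \<in> {1..n} \<and> v' \<in> {1..n} \<and> v \<noteq> v' \<and> w \<in> {1..k-1}}"

end

theory Submission
  imports Defs "HOL-Library.FuncSet"
begin

text \<open>
  Upper bound: build a tree whose nodes place the pigeons \<open>1, 2, \<dots>\<close> one after the other, each into
  a pair (place, hole). A node contributes the monomial saying that one of its choices is wrong; it
  is obtained from its \<open>n (k - 1)\<close> children by resolving along the two chains of 3-clauses, at
  cost \<open>O(k)\<close> per child, and every leaf contains a collision.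

  Lower bound: cut the places into \<open>k\<close> blocks, reserve a random place \<open>s u\<close> of block \<open>u\<close> for
  pigeon \<open>u\<close>, and give every other place a random bit as common value of its \<open>Q\<close> and \<open>Z\<close>
  variables. A monomial mentioning more than \<open>4 k log n\<close> places is killed by the
  random bits with overwhelming probability, and one mentioning fewer places rarely mentions \<open>d = \<lceil>(k - 1) / 2\<rceil>\<close> reserved ones.
  Hence in a small refutation some restriction leaves only monomials about fewer than \<open>d\<close> pigeons.
  Such a refutation of the pigeonhole principle with \<open>k - 1\<close> holes cannot exist over any field:
  assign ring-valued weights to the partial injections of at most \<open>d - 1\<close> pigeons so that the weight
  of each is the sum over its extensions by one pigeon. Every line has weighted sum 0 for all such
  weights, although the line 1 has the sum of the empty map. Closure under multiplication by a
  literal needs that weights given on all proper subsets of a set \<open>A\<close> of pigeons extend to \<open>A\<close>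
  whenever there are at least \<open>2 |A|\<close> holes.
\<close>

section \<open>Derivations with bounded size\<close>

lemma num_terms_lit_mult_le: "num_terms (lit_poly l * p) \<le> num_terms p"
proof -
  have "Poly_Mapping.keys (lit_poly l * p) \<subseteq> (+) (Poly_Mapping.single l 1) ` Poly_Mapping.keys p"
    using keys_mult[of "lit_poly l" p] by (auto simp: lit_poly_def split: if_splits)
  then have "num_terms (lit_poly l * p)
      \<le> card ((+) (Poly_Mapping.single l 1) ` Poly_Mapping.keys p)"
    unfolding num_terms_def by (intro card_mono) auto
  also have "\<dots> \<le> num_terms p" unfolding num_terms_def by (intro card_image_le) auto
  finally show ?thesis .
qed

lemma num_terms_add_le: "num_terms (p + q) \<le> num_terms p + num_terms q"
proof -
  have "num_terms (p + q) \<le> card (Poly_Mapping.keys p \<union> Poly_Mapping.keys q)"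
    unfolding num_terms_def by (intro card_mono Poly_Mapping.keys_add) auto
  then show ?thesis using card_Un_le unfolding num_terms_def by (rule order_trans)
qed

lemma num_terms_uminus: "num_terms (- p) = num_terms p"
  unfolding num_terms_def by (simp add: keys_def)

lemma num_terms_diff_le: "num_terms (p - q) \<le> num_terms p + num_terms q"
  using num_terms_add_le[of p "- q"] by (simp add: num_terms_uminus)

text \<open>A list of literals rather than a set: products become concatenations and repeated
  literals do no harm. \<open>L\<close> bounds the number of multiplication steps that bring the
  monomial into a derivation.\<close>

definition monomial_le :: "'v set \<Rightarrow> nat \<Rightarrow> ('v, 'a::field) pcr_poly \<Rightarrow> bool" where
  "monomial_le V L m \<longleftrightarrow>
     (\<exists>ls. length ls \<le> L \<and> set ls \<subseteq> literals_over V \<and> m = (\<Prod>l\<leftarrow>ls. lit_poly l))"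

lemma monomial_le_weaken: "monomial_le V L m \<Longrightarrow> L \<le> L' \<Longrightarrow> monomial_le V L' m"
  unfolding monomial_le_def by (blast intro: order_trans)

lemma monomial_le_one: "monomial_le V L 1"
  unfolding monomial_le_def by (intro exI[of _ "[]"]) simp

lemma monomial_le_lit: "l \<in> literals_over V \<Longrightarrow> monomial_le V 1 (lit_poly l)"
  unfolding monomial_le_def by (intro exI[of _ "[l]"]) simp

lemma monomial_le_mult:
  "monomial_le V L m \<Longrightarrow> monomial_le V L' m' \<Longrightarrow> monomial_le V (L + L') (m * m')"
  unfolding monomial_le_def
proof (elim exE conjE)
  fix ls ls' assume "length ls \<le> L" "set ls \<subseteq> literals_over V" "m = (\<Prod>l\<leftarrow>ls. lit_poly l)"
    "length ls' \<le> L'" "set ls' \<subseteq> literals_over V" "m' = (\<Prod>l\<leftarrow>ls'. lit_poly l)"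
  then show "\<exists>ls. length ls \<le> L + L' \<and> set ls \<subseteq> literals_over V \<and> m * m' = (\<Prod>l\<leftarrow>ls. lit_poly l)"
    by (intro exI[of _ "ls @ ls'"]) auto
qed

lemma monomial_le_mult_lit:
  "monomial_le V L m \<Longrightarrow> l \<in> literals_over V \<Longrightarrow> monomial_le V (Suc L) (m * lit_poly l)"
  using monomial_le_mult[OF _ monomial_le_lit] by fastforce

lemma monomial_le_prod:
  "finite J \<Longrightarrow> (\<And>j. j \<in> J \<Longrightarrow> monomial_le V c (f j)) \<Longrightarrow> monomial_le V (c * card J) (\<Prod>j\<in>J. f j)"
proof (induction J rule: finite_induct)
  case empty
  then show ?case by (simp add: monomial_le_one)
next
  case (insert j J)
  then show ?case using monomial_le_mult[of V c "f j" "c * card J"] by simp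
qed

lemma num_terms_one: "num_terms (1 :: ('v, 'a::field) pcr_poly) = 1"
  unfolding num_terms_def by simp

lemma num_terms_monomial:
  assumes "monomial_le V L m"
  shows "num_terms m \<le> 1"
proof -
  have "num_terms (\<Prod>l\<leftarrow>ls. lit_poly l :: ('a, 'b) pcr_poly) \<le> 1" for ls
  proof (induction ls)
    case (Cons l ls)
    then show ?case
      using num_terms_lit_mult_le[of l "\<Prod>l\<leftarrow>ls. lit_poly l :: ('a, 'b) pcr_poly"]
      by (simp only: list.map prod_list.Cons)
  qed (simp add: num_terms_one)
  then show ?thesis using assms unfolding monomial_le_def by blast
qed

section \<open>Derivations with a size bound\<close>

text \<open>Derivations will be combined by concatenation, without sharing lines between them, so
  the costs \<open>c\<close> add up as in a tree.\<close>

definition derives :: "'v set \<Rightarrow> 'v clause set \<Rightarrow> ('v, 'a::field) pcr_poly \<Rightarrow> nat \<Rightarrow> bool" where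
  "derives V F p c \<longleftrightarrow> (\<exists>\<pi>. \<pi> \<noteq> [] \<and> last \<pi> = p \<and> pcr_size \<pi> \<le> c \<and>
     (\<forall>i<length \<pi>. pcr_inference V F (set (take i \<pi>)) (\<pi> ! i)))"

lemma derives_mono: "derives V F p c \<Longrightarrow> c \<le> d \<Longrightarrow> derives V F p d"
  unfolding derives_def by (blast intro: order_trans)

lemma pcr_inference_mono: "pcr_inference V F E p \<Longrightarrow> E \<subseteq> E' \<Longrightarrow> pcr_inference V F E' p"
  unfolding pcr_inference_def by blast

lemma derivation_append:
  assumes "\<forall>i<length \<pi>. pcr_inference V F (set (take i \<pi>)) (\<pi> ! i)"
    and "\<And>i. i < length \<pi>' \<Longrightarrow> pcr_inference V F (set \<pi> \<union> set (take i \<pi>')) (\<pi>' ! i)"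
  shows "\<forall>i<length (\<pi> @ \<pi>'). pcr_inference V F (set (take i (\<pi> @ \<pi>'))) ((\<pi> @ \<pi>') ! i)"
proof (intro allI impI)
  fix i assume i: "i < length (\<pi> @ \<pi>')"
  show "pcr_inference V F (set (take i (\<pi> @ \<pi>'))) ((\<pi> @ \<pi>') ! i)"
  proof (cases "i < length \<pi>")
    case True
    then show ?thesis using assms(1) by (simp add: nth_append)
  next
    case False
    then show ?thesis using assms(2)[of "i - length \<pi>"] i by (simp add: nth_append)
  qed
qed

lemma derives_axiom:
  assumes "pcr_inference V F {} p" "num_terms p \<le> c"
  shows "derives V F p c"
  unfolding derives_def using assms by (intro exI[of _ "[p]"]) (simp add: pcr_size_def)

lemma derives_clause:
  assumes "C \<in> F" "num_terms (clause_poly C :: ('v, 'a::field) pcr_poly) \<le> c"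
  shows "derives V F (clause_poly C :: ('v, 'a) pcr_poly) c"
  using assms by (intro derives_axiom) (unfold pcr_inference_def, blast)

lemma derives_lit_mult:
  assumes "derives V F p c" "l \<in> literals_over V" "num_terms p \<le> t"
  shows "derives V F (lit_poly l * p) (c + t)"
proof -
  obtain \<pi> where \<pi>: "\<pi> \<noteq> []" "last \<pi> = p" "pcr_size \<pi> \<le> c"
    "\<forall>i<length \<pi>. pcr_inference V F (set (take i \<pi>)) (\<pi> ! i)"
    using assms(1) unfolding derives_def by blast
  have "p \<in> set \<pi>" using \<pi> by auto
  then have "pcr_inference V F (set \<pi>) (lit_poly l * p)"
    using assms(2) unfolding pcr_inference_def by blast
  then have "\<forall>i<length (\<pi> @ [lit_poly l * p]). pcr_inference V F
      (set (take i (\<pi> @ [lit_poly l * p]))) ((\<pi> @ [lit_poly l * p]) ! i)"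
    using \<pi>(4) by (intro derivation_append) auto
  moreover have "pcr_size (\<pi> @ [lit_poly l * p]) \<le> c + t"
    using \<pi>(3) num_terms_lit_mult_le[of l p] assms(3) by (simp add: pcr_size_def)
  ultimately show ?thesis unfolding derives_def
    by (intro exI[of _ "\<pi> @ [lit_poly l * p]"]) simp
qed

lemma derives_linear:
  assumes "derives V F p c" "derives V F q d" "num_terms (const_poly \<alpha> * p + const_poly \<beta> * q) \<le> t"
  shows "derives V F (const_poly \<alpha> * p + const_poly \<beta> * q) (c + d + t)"
proof -
  let ?r = "const_poly \<alpha> * p + const_poly \<beta> * q"
  obtain \<pi> where \<pi>: "\<pi> \<noteq> []" "last \<pi> = p" "pcr_size \<pi> \<le> c"
    "\<forall>i<length \<pi>. pcr_inference V F (set (take i \<pi>)) (\<pi> ! i)"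
    using assms(1) unfolding derives_def by blast
  obtain \<rho> where \<rho>: "\<rho> \<noteq> []" "last \<rho> = q" "pcr_size \<rho> \<le> d"
    "\<forall>i<length \<rho>. pcr_inference V F (set (take i \<rho>)) (\<rho> ! i)"
    using assms(2) unfolding derives_def by blast
  have "p \<in> set \<pi>" "q \<in> set \<rho>" using \<pi> \<rho> by auto
  then have "pcr_inference V F (set (\<pi> @ \<rho>)) ?r"
    unfolding pcr_inference_def set_append by blast
  then have inf: "\<And>i. i < length [?r] \<Longrightarrow>
      pcr_inference V F (set (\<pi> @ \<rho>) \<union> set (take i [?r])) ([?r] ! i)"
    by simp
  have "\<forall>i<length (\<pi> @ \<rho>). pcr_inference V F (set (take i (\<pi> @ \<rho>))) ((\<pi> @ \<rho>) ! i)"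
    using \<rho>(4) by (intro derivation_append[OF \<pi>(4)]) (blast intro: pcr_inference_mono)
  then have "\<forall>i<length ((\<pi> @ \<rho>) @ [?r]). pcr_inference V F
      (set (take i ((\<pi> @ \<rho>) @ [?r]))) (((\<pi> @ \<rho>) @ [?r]) ! i)"
    using inf by (rule derivation_append)
  moreover have "pcr_size ((\<pi> @ \<rho>) @ [?r]) \<le> c + d + t"
    using \<pi>(3) \<rho>(3) assms(3) by (simp add: pcr_size_def)
  ultimately show ?thesis unfolding derives_def
    by (intro exI[of _ "(\<pi> @ \<rho>) @ [?r]"]) simp
qed

lemma derives_add:
  assumes "derives V F p c" "derives V F q d" "num_terms (p + q) \<le> t"
  shows "derives V F (p + q) (c + d + t)"
  using derives_linear[OF assms(1,2), of 1 1 t] assms(3) by (simp add: const_poly_def)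

text \<open>One multiplication step per literal; no step increases the number of terms, so each of
  the at most \<open>L\<close> new lines costs at most \<open>t\<close>.\<close>

lemma derives_monomial_mult:
  assumes "monomial_le V L m" "derives V F p c" "num_terms p \<le> t"
  shows "derives V F (m * p) (c + L * t)"
proof -
  obtain ls where ls: "length ls \<le> L" "set ls \<subseteq> literals_over V" "m = (\<Prod>l\<leftarrow>ls. lit_poly l)"
    using assms(1) unfolding monomial_le_def by blast
  have "derives V F ((\<Prod>l\<leftarrow>ls. lit_poly l) * p) (c + length ls * t) \<and>
      num_terms ((\<Prod>l\<leftarrow>ls. lit_poly l) * p) \<le> t"
    using ls(2)
  proof (induction ls)
    case (Cons l ls)
    let ?q = "(\<Prod>l\<leftarrow>ls. lit_poly l) * p"
    have IH: "derives V F ?q (c + length ls * t)" "num_terms ?q \<le> t" using Cons by auto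
    have "derives V F (lit_poly l * ?q) (c + length ls * t + t)"
      using IH Cons.prems by (intro derives_lit_mult) simp_all
    moreover have "num_terms (lit_poly l * ?q) \<le> t"
      using num_terms_lit_mult_le IH(2) by (rule order_trans)
    moreover have "(\<Prod>l\<leftarrow>l # ls. lit_poly l) * p = lit_poly l * ?q"
      by (simp add: mult.assoc)
    moreover have "c + length (l # ls) * t = c + length ls * t + t" by simp
    ultimately show ?case by (simp only:)
  qed (use assms in simp)
  moreover have "c + length ls * t \<le> c + L * t" using ls(1) by simp
  ultimately show ?thesis unfolding ls(3) using derives_mono by blast
qed

section \<open>Resolution steps simulated by polynomials\<close>

text \<open>Writing y for the twin of x, resolution on x is the identity m = m (1 - x - y) + m x + m
  y. The axiom and its multiplication by m cost 3 + 3 L; the two sums have at most 2 and 1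
  terms.\<close>

lemma derives_resolve:
  fixes m :: "('v, 'a::field) pcr_poly"
  assumes m: "monomial_le V L m" and x: "x \<in> V"
    and pos: "derives V F (m * lit_poly (Pos x)) c" and neg: "derives V F (m * lit_poly (Neg x)) d"
  shows "derives V F m (c + d + 3 * L + 6)"
proof -
  let ?x = "lit_poly (Pos x) :: ('v, 'a) pcr_poly" and ?y = "lit_poly (Neg x) :: ('v, 'a) pcr_poly"
  have one: "num_terms ?x \<le> 1" "num_terms ?y \<le> 1" "num_terms m \<le> 1"
    using num_terms_lit_mult_le[of "Pos x" 1] num_terms_lit_mult_le[of "Neg x" 1]
      num_terms_monomial[OF m] by (auto simp: num_terms_one)
  have xs: "num_terms (m * ?y) \<le> 1"
    using num_terms_lit_mult_le[of "Neg x" m] one by (simp add: mult.commute)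
  have nx: "num_terms (1 - ?x - ?y) \<le> 3"
    using num_terms_diff_le[of "1 - ?x" ?y] num_terms_diff_le[of 1 ?x] one
      num_terms_one[where 'v='v and 'a='a] by linarith
  have "derives V F (1 - ?x - ?y) 3"
    using x nx by (intro derives_axiom) (auto simp: pcr_inference_def)
  then have "derives V F (m * (1 - ?x - ?y)) (3 + L * 3)"
    using nx by (rule derives_monomial_mult[OF m])
  moreover have "m * (1 - ?x - ?y) + m * ?x = m - m * ?y" by (simp add: algebra_simps)
  moreover have "num_terms (m - m * ?y) \<le> 2" using num_terms_diff_le[of m "m * ?y"] one xs by linarith
  ultimately have "derives V F (m - m * ?y) (3 + L * 3 + c + 2)"
    using derives_add[OF _ pos] by metis
  moreover have "(m - m * ?y) + m * ?y = m" by simp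
  ultimately have "derives V F m (3 + L * 3 + c + 2 + d + 1)"
    using derives_add[OF _ neg] one(3) by metis
  then show ?thesis by (rule derives_mono) simp
qed

lemma num_terms_mult_monomials: "monomial_le V L m \<Longrightarrow> monomial_le V L' m' \<Longrightarrow> num_terms (m * m') \<le> 1"
  using num_terms_monomial[OF monomial_le_mult] .

text \<open>Each premise is first multiplied by the side monomial of the other, at cost
  \<open>L + L'\<close> because all lines on the way are single terms; then both have the side
  monomial \<open>m * m'\<close> and can be resolved.\<close>

lemma derives_resolve_mult:
  fixes m :: "('v, 'a::field) pcr_poly"
  assumes m: "monomial_le V L m" "monomial_le V L' m'" and x: "x \<in> V"
    and pos: "derives V F (m * lit_poly (Pos x)) c" and neg: "derives V F (m' * lit_poly (Neg x)) d"
  shows "derives V F (m * m') (c + d + 4 * L + 4 * L' + 6)"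
proof -
  have l: "monomial_le V 1 (lit_poly (Pos x) :: ('v, 'a) pcr_poly)"
    "monomial_le V 1 (lit_poly (Neg x) :: ('v, 'a) pcr_poly)"
    using x by (simp_all add: monomial_le_lit literals_over_def del: One_nat_def)
  have "derives V F (m' * (m * lit_poly (Pos x))) (c + L' * 1)"
    by (rule derives_monomial_mult[OF m(2) pos num_terms_mult_monomials[OF m(1) l(1)]])
  moreover have "m' * (m * lit_poly (Pos x)) = m * m' * lit_poly (Pos x)" by (simp only: mult_ac)
  ultimately have 1: "derives V F (m * m' * lit_poly (Pos x)) (c + L')" by simp
  have "derives V F (m * (m' * lit_poly (Neg x))) (d + L * 1)"
    by (rule derives_monomial_mult[OF m(1) neg num_terms_mult_monomials[OF m(2) l(2)]])
  moreover have "m * (m' * lit_poly (Neg x)) = m * m' * lit_poly (Neg x)" by (simp only: mult_ac)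
  ultimately have 2: "derives V F (m * m' * lit_poly (Neg x)) (d + L)" by simp
  show ?thesis
    by (rule derives_mono[OF derives_resolve[OF monomial_le_mult[OF m] x 1 2]]) simp
qed

lemma literals_overI [simp]: "x \<in> V \<Longrightarrow> Pos x \<in> literals_over V" "x \<in> V \<Longrightarrow> Neg x \<in> literals_over V"
  by (auto simp: literals_over_def)

text \<open>The 3-clause loses \<open>y\<close> first, with side monomial m g x, and then
  \<open>x\<close>, with side monomial m g. Only weakenings by monomials and two resolutions occur,
  whence the cost is linear in \<open>L\<close>.\<close>

lemma derives_resolve_clause3:
  fixes m :: "('v, 'a::field) pcr_poly"
  assumes m: "monomial_le V L m" and g: "g \<in> literals_over V" and xy: "x \<in> V" "y \<in> V"
    and ax: "derives V F (lit_poly g * lit_poly (Pos x) * lit_poly (Pos y) :: ('v, 'a) pcr_poly) c"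
    and dx: "derives V F (m * lit_poly (Neg x)) c\<^sub>x" and dy: "derives V F (m * lit_poly (Neg y)) c\<^sub>y"
  shows "derives V F (m * lit_poly g) (c + c\<^sub>x + c\<^sub>y + 7 * L + 24)"
proof -
  let ?g = "lit_poly g :: ('v, 'a) pcr_poly"
  let ?x = "lit_poly (Pos x) :: ('v, 'a) pcr_poly" and ?y = "lit_poly (Pos y) :: ('v, 'a) pcr_poly"
  have gm: "monomial_le V 1 ?g" "monomial_le V 1 ?x" "monomial_le V 1 ?y"
    "monomial_le V 1 (lit_poly (Neg x) :: ('v, 'a) pcr_poly)"
    "monomial_le V 1 (lit_poly (Neg y) :: ('v, 'a) pcr_poly)"
    using g xy by (simp_all add: monomial_le_lit del: One_nat_def)
  have gx: "monomial_le V 2 (?g * ?x)" using monomial_le_mult[OF gm(1,2)] by (simp add: numeral_2_eq_2)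
  have "derives V F (m * (?g * ?x * ?y)) (c + L * 1)"
    by (rule derives_monomial_mult[OF m ax num_terms_mult_monomials[OF gx gm(3)]])
  then have 1: "derives V F (m * (?g * ?x) * ?y) (c + L)" by (simp add: mult_ac)
  have "derives V F ((?g * ?x) * (m * lit_poly (Neg y))) (c\<^sub>y + 2 * 1)"
    by (rule derives_monomial_mult[OF gx dy num_terms_mult_monomials[OF m gm(5)]])
  then have 2: "derives V F (m * (?g * ?x) * lit_poly (Neg y)) (c\<^sub>y + 2)" by (simp add: mult_ac)
  have 3: "derives V F (m * (?g * ?x)) (c + L + (c\<^sub>y + 2) + 3 * (L + 2) + 6)"
    by (rule derives_resolve[OF monomial_le_mult[OF m gx] xy(2) 1 2])
  have 4: "derives V F (?g * (m * lit_poly (Neg x))) (c\<^sub>x + 1 * 1)"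
    by (rule derives_monomial_mult[OF gm(1) dx num_terms_mult_monomials[OF m gm(4)]])
  have "derives V F (m * ?g) (c + L + (c\<^sub>y + 2) + 3 * (L + 2) + 6 + (c\<^sub>x + 1) + 3 * (L + 1) + 6)"
    using 3 4 by (intro derives_resolve[OF monomial_le_mult[OF m gm(1)] xy(1)]) (simp_all add: mult_ac)
  then show ?thesis by (rule derives_mono) simp
qed

text \<open>
  The 3-clauses encode \<open>\<not> g \<longrightarrow> x 1 \<or> \<dots> \<or> x M\<close> by means of the extension variables \<open>z\<close>.
\<close>

lemma derives_chain:
  fixes m :: "('v, 'a::field) pcr_poly"
  assumes m: "monomial_le V L m" and M: "3 \<le> M" and g: "g \<in> literals_over V"
    and x: "\<And>i. i \<in> {1..M} \<Longrightarrow> x i \<in> V" and z: "\<And>i. i \<in> {1..M - 2} \<Longrightarrow> z i \<in> V"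
    and first: "derives V F (lit_poly g * lit_poly (Pos (x 1)) * lit_poly (Pos (z 1)) :: ('v, 'a) pcr_poly) 1"
    and mid: "\<And>i. i \<in> {1..M - 3} \<Longrightarrow>
       derives V F (lit_poly (Neg (z i)) * lit_poly (Pos (x (i + 1))) * lit_poly (Pos (z (i + 1))) :: ('v, 'a) pcr_poly) 1"
    and final: "derives V F
       (lit_poly (Neg (z (M - 2))) * lit_poly (Pos (x (M - 1))) * lit_poly (Pos (x M)) :: ('v, 'a) pcr_poly) 1"
    and d: "\<And>i. i \<in> {1..M} \<Longrightarrow> derives V F (m * lit_poly (Neg (x i))) c"
  shows "derives V F (m * lit_poly g) (M * c + M * (7 * L + 25))"
proof -
  obtain N where N: "M = N + 3" using M by (metis le_add_diff_inverse2)
  \<comment> \<open>The chain is resolved from its last clause towards its first: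
    \<open>j + 1\<close> clauses have been used once the negated \<open>z (N + 1 - j)\<close> is
    reached, and each costs one more premise of cost \<open>c\<close>.\<close>
  have "derives V F (m * lit_poly (Neg (z (N + 1 - j)))) ((j + 2) * c + (j + 1) * (7 * L + 25))"
    if "j \<le> N" for j
    using that
  proof (induction j)
    case 0
    have "derives V F (m * lit_poly (Neg (z (N + 1)))) (1 + c + c + 7 * L + 24)"
      using final z[of "N + 1"]
      by (intro derives_resolve_clause3[OF m _ x[of "N + 2"] x[of "N + 3"] _ d d]) (simp_all add: N)
    then show ?case by (simp add: algebra_simps)
  next
    case (Suc j)
    define i where "i = N - j"
    have i: "N + 1 - Suc j = i" "N + 1 - j = i + 1" "i \<in> {1..M - 3}"
      using Suc.prems by (auto simp: i_def N)
    have IH: "derives V F (m * lit_poly (Neg (z (i + 1)))) ((j + 2) * c + (j + 1) * (7 * L + 25))"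
      using Suc.IH Suc.prems i(2) by simp
    have "derives V F (m * lit_poly (Neg (z i)))
        (1 + c + ((j + 2) * c + (j + 1) * (7 * L + 25)) + 7 * L + 24)"
      by (rule derives_resolve_clause3[OF m _ x z mid[OF i(3)] d IH])
        (use i(3) z[of i] in \<open>auto simp: N\<close>)
    then show ?case unfolding i(1) by (rule derives_mono) (simp add: algebra_simps)
  qed
  \<comment> \<open>At \<open>j = N\<close> the index is 1. The first clause remains; it loses
    \<open>x 1\<close> and \<open>z 1\<close> and leaves the guard \<open>g\<close>.\<close>
  from this[of N] have "derives V F (m * lit_poly (Neg (z 1))) ((N + 2) * c + (N + 1) * (7 * L + 25))"
    by simp
  then have "derives V F (m * lit_poly g) (1 + c + ((N + 2) * c + (N + 1) * (7 * L + 25)) + 7 * L + 24)"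
    using M by (intro derives_resolve_clause3[OF m g x z first d]) auto
  then show ?thesis by (rule derives_mono) (simp add: N algebra_simps)
qed

section \<open>The refutation\<close>

text \<open>A finite clause is a product of literals; over an infinite set the product is 1 by
  convention, again a single term.\<close>

lemma num_terms_clause: "num_terms (clause_poly C :: ('v, 'a::field) pcr_poly) \<le> 1"
proof (cases "finite C")
  case True
  have "monomial_le UNIV (1 * card C) (clause_poly C :: ('v, 'a) pcr_poly)"
    unfolding clause_poly_def
    using True by (intro monomial_le_prod monomial_le_lit) (auto simp: literals_over_def, metis literal.exhaust rangeI)
  then show ?thesis by (rule num_terms_monomial)
qed (simp add: clause_poly_def num_terms_one)

lemma derives_clause2:
  assumes "{a, b} \<in> F" "a \<noteq> b"
  shows "derives V F (lit_poly a * lit_poly b :: ('v, 'a::field) pcr_poly) 1"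
  using derives_clause[OF assms(1) num_terms_clause, of V] assms(2) by (simp add: clause_poly_def)

lemma derives_clause3:
  assumes "{a, b, c} \<in> F" "a \<noteq> b" "a \<noteq> c" "b \<noteq> c"
  shows "derives V F (lit_poly a * lit_poly b * lit_poly c :: ('v, 'a::field) pcr_poly) 1"
  using derives_clause[OF assms(1) num_terms_clause, of V] assms(2-4)
  by (simp add: clause_poly_def mult.assoc)

section \<open>The tree of placements\<close>

text \<open>Here \<open>b\<close> is a pair (place, hole). As true is 0, the monomial says that
  pigeon \<open>u\<close> is not at the place or the place does not use the hole.\<close>

definition placement_poly :: "nat \<Rightarrow> nat \<times> nat \<Rightarrow> (erphp_var, 'a::field) pcr_poly" where
  "placement_poly u b = lit_poly (Neg (P u (fst b))) * lit_poly (Neg (Q (fst b) (snd b)))"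

text \<open>The list records the choices for pigeons 1, 2, ... in this order; list positions start
  at 0, which explains \<open>Suc j\<close>.\<close>

definition node_poly :: "(nat \<times> nat) list \<Rightarrow> (erphp_var, 'a::field) pcr_poly" where
  "node_poly a = (\<Prod>j<length a. placement_poly (Suc j) (a ! j))"

lemma node_poly_Nil: "node_poly [] = 1"
  by (simp add: node_poly_def)

lemma node_poly_snoc:
  "node_poly (a @ [b]) = node_poly a * placement_poly (Suc (length a)) b"
  by (simp add: node_poly_def nth_append)

lemma erphp_varsI:
  "u \<in> {1..k} \<Longrightarrow> v \<in> {1..n} \<Longrightarrow> P u v \<in> erphp_vars k n"
  "u \<in> {1..k} \<Longrightarrow> v \<in> {2..n-2} \<Longrightarrow> Y u v \<in> erphp_vars k n"
  "v \<in> {1..n} \<Longrightarrow> R v \<in> erphp_vars k n"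
  "v \<in> {1..n} \<Longrightarrow> v' \<in> {1..n} \<Longrightarrow> v \<noteq> v' \<Longrightarrow> RR v v' \<in> erphp_vars k n"
  "v \<in> {1..n} \<Longrightarrow> w \<in> {1..k-1} \<Longrightarrow> Q v w \<in> erphp_vars k n"
  "v \<in> {1..n} \<Longrightarrow> w \<in> {1..k-3} \<Longrightarrow> Z v w \<in> erphp_vars k n"
  by (simp_all add: erphp_vars_def)

text \<open>The ten families in the order of the formula; later proofs select them by
  position.\<close>

lemma erphpI:
  "u \<in> {1..k} \<Longrightarrow> {Pos (P u 1), Pos (P u 2), Pos (Y u 2)} \<in> erphp k n"
  "u \<in> {1..k} \<Longrightarrow> v \<in> {2..n-3} \<Longrightarrow> {Neg (Y u v), Pos (P u (v+1)), Pos (Y u (v+1))} \<in> erphp k n"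
  "u \<in> {1..k} \<Longrightarrow> {Neg (Y u (n-2)), Pos (P u (n-1)), Pos (P u n)} \<in> erphp k n"
  "v \<in> {1..n} \<Longrightarrow> {Neg (R v), Pos (Q v 1), Pos (Z v 1)} \<in> erphp k n"
  "v \<in> {1..n} \<Longrightarrow> w \<in> {1..k-4} \<Longrightarrow> {Neg (Z v w), Pos (Q v (w+1)), Pos (Z v (w+1))} \<in> erphp k n"
  "v \<in> {1..n} \<Longrightarrow> {Neg (Z v (k-3)), Pos (Q v (k-2)), Pos (Q v (k-1))} \<in> erphp k n"
  "u \<in> {1..k} \<Longrightarrow> u' \<in> {1..k} \<Longrightarrow> u \<noteq> u' \<Longrightarrow> v \<in> {1..n} \<Longrightarrow> {Neg (P u v), Neg (P u' v)} \<in> erphp k n"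
  "u \<in> {1..k} \<Longrightarrow> v \<in> {1..n} \<Longrightarrow> {Neg (P u v), Pos (R v)} \<in> erphp k n"
  "v \<in> {1..n} \<Longrightarrow> v' \<in> {1..n} \<Longrightarrow> v \<noteq> v' \<Longrightarrow> {Neg (R v), Neg (R v'), Pos (RR v v')} \<in> erphp k n"
  "v \<in> {1..n} \<Longrightarrow> v' \<in> {1..n} \<Longrightarrow> v \<noteq> v' \<Longrightarrow> w \<in> {1..k-1} \<Longrightarrow>
     {Neg (RR v v'), Neg (Q v w), Neg (Q v' w)} \<in> erphp k n"
  unfolding erphp_def Un_iff
  subgoal by (rule disjI1, rule disjI1, rule disjI1, rule disjI1, rule disjI1, rule disjI1, rule disjI1, rule disjI1, rule disjI1, blast)
  subgoal by (rule disjI1, rule disjI1, rule disjI1, rule disjI1, rule disjI1, rule disjI1, rule disjI1, rule disjI1, rule disjI2, blast)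
  subgoal by (rule disjI1, rule disjI1, rule disjI1, rule disjI1, rule disjI1, rule disjI1, rule disjI1, rule disjI2, blast)
  subgoal by (rule disjI1, rule disjI1, rule disjI1, rule disjI1, rule disjI1, rule disjI1, rule disjI2, blast)
  subgoal by (rule disjI1, rule disjI1, rule disjI1, rule disjI1, rule disjI1, rule disjI2, blast)
  subgoal by (rule disjI1, rule disjI1, rule disjI1, rule disjI1, rule disjI2, blast)
  subgoal by (rule disjI1, rule disjI1, rule disjI1, rule disjI2, blast)
  subgoal by (rule disjI1, rule disjI1, rule disjI2, blast)
  subgoal by (rule disjI1, rule disjI2, blast)
  subgoal by (rule disjI2, blast)
  done

lemma monomial_placement:
  assumes "u \<in> {1..k}" "fst b \<in> {1..n}" "snd b \<in> {1..k-1}"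
  shows "monomial_le (erphp_vars k n) 2 (placement_poly u b)"
  unfolding placement_poly_def numeral_2_eq_2
  using assms by (intro monomial_le_mult_lit monomial_le_lit[unfolded One_nat_def]) (simp_all add: erphp_varsI)

text \<open>The choices available at a node: a place together with a hole, so the tree has branching
  number \<open>n * (k - 1)\<close>.\<close>

definition places :: "nat \<Rightarrow> nat \<Rightarrow> (nat \<times> nat) set" where
  "places k n = {1..n} \<times> {1..k-1}"

lemma monomial_node:
  assumes "length a \<le> k" "set a \<subseteq> places k n"
  shows "monomial_le (erphp_vars k n) (2 * length a) (node_poly a)"
proof -
  have "a ! j \<in> places k n" if "j < length a" for j using assms(2) that nth_mem by blast
  then have "monomial_le (erphp_vars k n) (2 * card {..<length a})
      (\<Prod>j<length a. placement_poly (Suc j) (a ! j))"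
    using assms(1) by (intro monomial_le_prod monomial_placement) (auto simp: places_def mem_Times_iff)
  then show ?thesis by (simp add: node_poly_def)
qed

text \<open>Two different places use the same hole \<open>w\<close>. Resolving on
  \<open>RR v v'\<close> shows that not both are in use; resolving on \<open>R v\<close> and
  \<open>R v'\<close> replaces this by the pigeons sitting there. The costs of the three resolutions
  accumulate as 24, 47, 70.\<close>

lemma derives_conflict:
  assumes uv: "u \<in> {1..k}" "u' \<in> {1..k}" "v \<in> {1..n}" "v' \<in> {1..n}" "v \<noteq> v'" "w \<in> {1..k-1}"
  shows "derives (erphp_vars k n) (erphp k n)
    (placement_poly u (v, w) * placement_poly u' (v', w) :: (erphp_var, 'a::field) pcr_poly) 70"
proof -
  let ?V = "erphp_vars k n" and ?D = "derives (erphp_vars k n) (erphp k n)"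
  let ?p = "lit_poly (Neg (P u v)) :: (erphp_var, 'a) pcr_poly"
  let ?p' = "lit_poly (Neg (P u' v')) :: (erphp_var, 'a) pcr_poly"
  let ?q = "lit_poly (Neg (Q v w)) :: (erphp_var, 'a) pcr_poly"
  let ?q' = "lit_poly (Neg (Q v' w)) :: (erphp_var, 'a) pcr_poly"
  let ?r = "lit_poly (Neg (R v)) :: (erphp_var, 'a) pcr_poly"
  let ?r' = "lit_poly (Neg (R v')) :: (erphp_var, 'a) pcr_poly"
  have mono: "monomial_le ?V 1 ?p" "monomial_le ?V 1 ?p'" "monomial_le ?V 1 ?q"
    "monomial_le ?V 1 ?q'" "monomial_le ?V 1 ?r" "monomial_le ?V 1 ?r'"
    using uv by (simp_all add: monomial_le_lit erphp_varsI del: One_nat_def)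
  have qq: "monomial_le ?V 2 (?q * ?q')" and rr: "monomial_le ?V 2 (?r * ?r')"
    using monomial_le_mult[OF mono(3,4)] monomial_le_mult[OF mono(5,6)] by (simp_all add: numeral_2_eq_2)
  have rqq: "monomial_le ?V 3 (?r' * (?q * ?q'))" and pqq: "monomial_le ?V 3 (?p * (?q * ?q'))"
    using monomial_le_mult[OF mono(6) qq] monomial_le_mult[OF mono(1) qq] by (simp_all add: eval_nat_numeral)
  have 1: "?D (?r * ?r' * lit_poly (Pos (RR v v'))) 1"
    by (intro derives_clause3 erphpI(9)) (use uv in simp_all)
  have "?D (lit_poly (Neg (RR v v')) * ?q * ?q') 1"
    by (intro derives_clause3 erphpI(10)) (use uv in simp_all)
  then have 2: "?D (?q * ?q' * lit_poly (Neg (RR v v'))) 1" by (simp only: mult_ac)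
  have 3: "?D (?p * lit_poly (Pos (R v))) 1"
    by (intro derives_clause2 erphpI(8)) (use uv in simp_all)
  have 4: "?D (?p' * lit_poly (Pos (R v'))) 1"
    by (intro derives_clause2 erphpI(8)) (use uv in simp_all)
  have "?D (?r * ?r' * (?q * ?q')) (1 + 1 + 4 * 2 + 4 * 2 + 6)"
    using uv by (intro derives_resolve_mult[OF rr qq _ 1 2]) (simp add: erphp_varsI)
  then have 5: "?D (?r' * (?q * ?q') * ?r) 24" by (simp add: mult_ac)
  have "?D (?p * (?r' * (?q * ?q'))) (1 + 24 + 4 * 1 + 4 * 3 + 6)"
    using uv by (intro derives_resolve_mult[OF mono(1) rqq _ 3 5]) (simp add: erphp_varsI)
  then have 6: "?D (?p * (?q * ?q') * ?r') 47" by (simp add: mult_ac)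
  have "?D (?p' * (?p * (?q * ?q'))) (1 + 47 + 4 * 1 + 4 * 3 + 6)"
    using uv by (intro derives_resolve_mult[OF mono(2) pqq _ 4 6]) (simp add: erphp_varsI)
  then show ?thesis by (simp add: placement_poly_def mult_ac)
qed

text \<open>There are \<open>k\<close> pigeons and \<open>k - 1\<close> holes, so two pigeons share
  a place, which an axiom forbids, or have distinct places with a common hole, which is
  \<open>derives_conflict\<close>. The factors of the other pigeons are multiplied in
  afterwards.\<close>

lemma derives_leaf:
  assumes k: "4 \<le> k" and a: "length a = k" "set a \<subseteq> places k n"
  shows "derives (erphp_vars k n) (erphp k n) (node_poly a :: (erphp_var, 'a::field) pcr_poly) (20 * k)"
proof -
  let ?V = "erphp_vars k n" and ?D = "derives (erphp_vars k n) (erphp k n)"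
  let ?f = "\<lambda>j. placement_poly (Suc j) (a ! j) :: (erphp_var, 'a) pcr_poly"
  have pl: "fst (a ! j) \<in> {1..n}" "snd (a ! j) \<in> {1..k-1}" if "j < k" for j
  proof -
    have "a ! j \<in> places k n" using a nth_mem[of j a] that by blast
    then show "fst (a ! j) \<in> {1..n}" "snd (a ! j) \<in> {1..k-1}" by (auto simp: places_def)
  qed
  have split: "node_poly a = (\<Prod>x\<in>{..<k} - {i} - {j}. ?f x) * (?f i * ?f j)"
    "monomial_le ?V (2 * (k - 2)) (\<Prod>x\<in>{..<k} - {i} - {j}. ?f x)"
    if "i < k" "j < k" "i \<noteq> j" for i j
  proof -
    have "(\<Prod>x<k. ?f x) = ?f i * (\<Prod>x\<in>{..<k} - {i}. ?f x)"
      using that by (intro prod.remove) auto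
    also have "(\<Prod>x\<in>{..<k} - {i}. ?f x) = ?f j * (\<Prod>x\<in>{..<k} - {i} - {j}. ?f x)"
      using that by (intro prod.remove) auto
    finally show "node_poly a = (\<Prod>x\<in>{..<k} - {i} - {j}. ?f x) * (?f i * ?f j)"
      by (simp add: node_poly_def a mult_ac)
    have "card ({..<k} - {i} - {j}) = k - 2" using that by (simp add: card_Diff_singleton)
    moreover have "monomial_le ?V (2 * card ({..<k} - {i} - {j})) (\<Prod>x\<in>{..<k} - {i} - {j}. ?f x)"
      using pl by (intro monomial_le_prod monomial_placement) auto
    ultimately show "monomial_le ?V (2 * (k - 2)) (\<Prod>x\<in>{..<k} - {i} - {j}. ?f x)" by simp
  qed
  have two: "num_terms (?f i * ?f j) \<le> 1" if "i < k" "j < k" for i j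
    using that pl[OF that(1)] pl[OF that(2)]
    by (intro num_terms_mult_monomials[OF monomial_placement[of _ k _ n] monomial_placement[of _ k _ n]]) auto
  have finish: "?D (node_poly a :: (erphp_var, 'a) pcr_poly) (20 * k)" if "i < k" "j < k" "i \<noteq> j" "?D (?f i * ?f j) 70" for i j
  proof -
    have "?D ((\<Prod>x\<in>{..<k} - {i} - {j}. ?f x) * (?f i * ?f j)) (70 + 2 * (k - 2) * 1)"
      using that by (intro derives_monomial_mult split two)
    \<comment> \<open>The inequality \<open>70 + 2 * (k - 2) \<le> 20 * k\<close> holds from
      \<open>k = 4\<close> on.\<close>
    then show ?thesis unfolding split(1)[OF that(1-3)]
      by (rule derives_mono) (use k in linarith)
  qed
  show ?thesis
  proof (cases "inj_on (\<lambda>j. fst (a ! j)) {..<k}")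
    case False
    then obtain i j where ij: "i < k" "j < k" "i \<noteq> j" "fst (a ! i) = fst (a ! j)"
      by (auto simp: inj_on_def)
    define v where "v = fst (a ! i)"
    let ?p = "lit_poly (Neg (P (Suc i) v)) * lit_poly (Neg (P (Suc j) v)) :: (erphp_var, 'a) pcr_poly"
    let ?q = "lit_poly (Neg (Q v (snd (a ! i)))) * lit_poly (Neg (Q v (snd (a ! j)))) :: (erphp_var, 'a) pcr_poly"
    have v: "v \<in> {1..n}" using pl ij by (auto simp: v_def)
    have "?D ?p 1" using ij v by (intro derives_clause2 erphpI(7)) auto
    moreover have "num_terms ?p \<le> 1"
      using num_terms_clause[of "{Neg (P (Suc i) v), Neg (P (Suc j) v)}", where 'a='a] ij
      by (simp add: clause_poly_def)
    moreover have "monomial_le ?V 2 ?q"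
      using v pl ij unfolding numeral_2_eq_2
      by (intro monomial_le_mult_lit monomial_le_lit[unfolded One_nat_def] literals_overI erphp_varsI) auto
    ultimately have "?D (?q * ?p) (1 + 2 * 1)" by (intro derives_monomial_mult)
    moreover have "?q * ?p = ?f i * ?f j"
      unfolding placement_poly_def v_def ij(4) by (simp only: mult_ac)
    ultimately have "?D (?f i * ?f j) (1 + 2 * 1)" by (simp only:)
    then have "?D (?f i * ?f j) 70" by (rule derives_mono) simp
    then show ?thesis by (rule finish[OF ij(1-3)])
  next
    case True
    have "\<not> inj_on (\<lambda>j. snd (a ! j)) {..<k}"
    proof
      assume "inj_on (\<lambda>j. snd (a ! j)) {..<k}"
      then have "card {..<k} \<le> card {1..k-1}" using pl by (intro card_inj_on_le) auto
      then show False using k by simp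
    qed
    then obtain i j where ij: "i < k" "j < k" "i \<noteq> j" "snd (a ! i) = snd (a ! j)"
      by (auto simp: inj_on_def)
    have "fst (a ! i) \<noteq> fst (a ! j)" using True ij by (auto simp: inj_on_def)
    then have "?D (placement_poly (Suc i) (fst (a ! i), snd (a ! i)) *
        placement_poly (Suc j) (fst (a ! j), snd (a ! i))) 70"
      using ij pl[OF ij(1)] pl[OF ij(2)] by (intro derives_conflict) auto
    moreover have "(fst (a ! i), snd (a ! i)) = a ! i" "(fst (a ! j), snd (a ! i)) = a ! j"
      using ij(4) by (simp_all add: prod_eq_iff)
    ultimately have "?D (?f i * ?f j) 70" by (simp only:)
    then show ?thesis by (rule finish[OF ij(1-3)])
  qed
qed

text \<open>For each place \<open>v\<close>, the chain over the holes removes the \<open>Q\<close>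
  literals of the children and a resolution on \<open>R v\<close> leaves the node together with the
  negated \<open>P u v\<close>, where \<open>u\<close> is the next pigeon. The chain over the places
  then removes these literals.\<close>

lemma derives_node:
  assumes k: "4 \<le> k" and n: "4 \<le> n" and a: "length a < k" "set a \<subseteq> places k n"
    and child: "\<And>b. b \<in> places k n \<Longrightarrow>
      derives (erphp_vars k n) (erphp k n) (node_poly (a @ [b]) :: (erphp_var, 'a::field) pcr_poly) t"
  shows "derives (erphp_vars k n) (erphp k n) (node_poly a :: (erphp_var, 'a) pcr_poly)
    (n * (k - 1) * t + 42 * n * k ^ 2)"
proof -
  let ?V = "erphp_vars k n" and ?D = "derives (erphp_vars k n) (erphp k n)"
  let ?A = "node_poly a :: (erphp_var, 'a) pcr_poly" and ?u = "Suc (length a)"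
  let ?p = "\<lambda>v. lit_poly (Neg (P ?u v)) :: (erphp_var, 'a) pcr_poly"
  have A: "monomial_le ?V (2 * length a) ?A" using a by (intro monomial_node) auto
  have A2: "monomial_le ?V (2 * k - 2) ?A"
    using A a(1) by (intro monomial_le_weaken[OF A]) linarith
  have u: "?u \<in> {1..k}" using a by auto
  \<comment> \<open>The cost for one place: \<open>k - 1\<close> children, the chain over the holes,
    and the resolution on \<open>R v\<close>.\<close>
  define c where "c = (k - 1) * t + k * (14 * k + 25)"
  have c: "?D (?A * ?p v) c" if v: "v \<in> {1..n}" for v
  proof -
    have Av: "monomial_le ?V (2 * k - 1) (?A * ?p v)"
      using monomial_le_mult_lit[OF A2, of "Neg (P ?u v)"] u v k
      by (simp add: erphp_varsI Suc_diff_Suc numeral_2_eq_2)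
    have "?D (?A * ?p v * lit_poly (Neg (R v))) ((k - 1) * t + (k - 1) * (7 * (2 * k - 1) + 25))"
    proof (rule derives_chain[OF Av, where x = "Q v" and z = "Z v"])
      fix w assume w: "w \<in> {1..k - 1}"
      then show "Q v w \<in> ?V" using v by (simp add: erphp_varsI)
      have "(v, w) \<in> places k n" using v w by (simp add: places_def)
      from child[OF this] show "?D (?A * ?p v * lit_poly (Neg (Q v w))) t"
        by (simp add: node_poly_snoc placement_poly_def mult_ac)
    next
      fix w assume "w \<in> {1..k - 1 - 3}"
      then show "?D (lit_poly (Neg (Z v w)) * lit_poly (Pos (Q v (w + 1))) *
          lit_poly (Pos (Z v (w + 1))) :: (erphp_var, 'a) pcr_poly) 1"
        using v by (intro derives_clause3 erphpI(5)) auto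
    next
      show "?D (lit_poly (Neg (Z v (k - 1 - 2))) * lit_poly (Pos (Q v (k - 1 - 1))) *
          lit_poly (Pos (Q v (k - 1))) :: (erphp_var, 'a) pcr_poly) 1"
        using derives_clause3[OF erphpI(6)[OF v], of k ?V, where 'a='a] k
        by (simp add: numeral_3_eq_3 numeral_2_eq_2)
      show "?D (lit_poly (Neg (R v)) * lit_poly (Pos (Q v 1)) * lit_poly (Pos (Z v 1))
          :: (erphp_var, 'a) pcr_poly) 1"
        using v by (intro derives_clause3 erphpI(4)) auto
    qed (use k v in \<open>auto simp: erphp_varsI\<close>)
    moreover have "?D (?p v * lit_poly (Pos (R v))) 1"
      using u v by (intro derives_clause2 erphpI(8)) auto
    then have "?D (?A * (?p v * lit_poly (Pos (R v)))) (1 + (2 * k - 2) * 1)"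
      using num_terms_clause[of "{Neg (P ?u v), Pos (R v)}", where 'a='a]
      by (intro derives_monomial_mult[OF A2]) (simp_all add: clause_poly_def)
    ultimately have "?D (?A * ?p v) (1 + (2 * k - 2) * 1 +
        ((k - 1) * t + (k - 1) * (7 * (2 * k - 1) + 25)) + 3 * (2 * k - 1) + 6)"
      using v by (intro derives_resolve[OF Av, of "R v"]) (simp_all add: erphp_varsI mult_ac)
    moreover obtain k' where "k = k' + 1" using k by (metis add.commute le_add_diff_inverse le_trans one_le_numeral)
    ultimately show ?thesis
      by (elim derives_mono) (simp add: c_def algebra_simps)
  qed
  \<comment> \<open>The chain over the places has no guard, so \<open>P u 1\<close> acts as one. The
    chain then covers the places from 2 to \<open>n\<close>, hence its length \<open>n - 1\<close>
    and the index shifts. A last resolution on \<open>P u 1\<close> removes the guard.\<close>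
  have "?D (?A * lit_poly (Pos (P ?u 1))) ((n - 1) * c + (n - 1) * (7 * (2 * k - 2) + 25))"
  proof (rule derives_chain[OF A2, where x = "\<lambda>i. P ?u (i + 1)" and z = "\<lambda>i. Y ?u (i + 1)"])
    show "?D (lit_poly (Pos (P ?u 1)) * lit_poly (Pos (P ?u (1 + 1))) * lit_poly (Pos (Y ?u (1 + 1)))
        :: (erphp_var, 'a) pcr_poly) 1"
      using derives_clause3[OF erphpI(1)[OF u, of n], of ?V, where 'a='a] by (simp add: numeral_2_eq_2)
    show "?D (lit_poly (Neg (Y ?u (n - 1 - 2 + 1))) * lit_poly (Pos (P ?u (n - 1 - 1 + 1))) *
        lit_poly (Pos (P ?u (n - 1 + 1))) :: (erphp_var, 'a) pcr_poly) 1"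
      using derives_clause3[OF erphpI(3)[OF u, of n], of ?V, where 'a='a] n
      by (simp add: numeral_2_eq_2 Suc_diff_Suc)
  next
    fix i assume "i \<in> {1..n - 1 - 3}"
    then show "?D (lit_poly (Neg (Y ?u (i + 1))) * lit_poly (Pos (P ?u (i + 1 + 1))) *
        lit_poly (Pos (Y ?u (i + 1 + 1))) :: (erphp_var, 'a) pcr_poly) 1"
      using u by (intro derives_clause3 erphpI(2)) auto
  next
    fix i assume "i \<in> {1..n - 1}"
    then show "?D (?A * ?p (i + 1)) c" using n by (intro c) auto
  qed (use n u in \<open>auto simp: erphp_varsI\<close>)
  then have "?D ?A ((n - 1) * c + (n - 1) * (7 * (2 * k - 2) + 25) + c + 3 * (2 * k - 2) + 6)"
    using c[of 1] n u by (intro derives_resolve[OF A2, of "P ?u 1"]) (simp_all add: erphp_varsI)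
  moreover have "(n - 1) * c + (n - 1) * (7 * (2 * k - 2) + 25) + c + 3 * (2 * k - 2) + 6
      \<le> n * (k - 1) * t + 42 * n * k ^ 2"
  proof -
    \<comment> \<open>Substituting \<open>n = m + 1\<close> and \<open>k = j + 4\<close> turns the
      truncated subtractions into polynomials with natural coefficients.\<close>
    obtain m where m: "n = m + 1" using n by (metis add.commute le_add_diff_inverse le_trans one_le_numeral)
    obtain j where j: "k = j + 4" using k by (metis add.commute le_add_diff_inverse)
    show ?thesis by (simp add: c_def m j algebra_simps power2_eq_square)
  qed
  ultimately show ?thesis by (rule derives_mono)
qed

text \<open>Induction on the number \<open>j\<close> of pigeons still to be placed. The subtracted
  \<open>168 * k\<close> makes the bound inductive: multiplied by the branching number N it pays for
  the additive term \<open>42 * n * k ^ 2\<close> of a node and for the next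
  \<open>168 * k\<close>.\<close>

lemma derives_tree:
  assumes k: "4 \<le> k" and n: "4 \<le> n" and a: "length a + j = k" "set a \<subseteq> places k n"
  shows "derives (erphp_vars k n) (erphp k n) (node_poly a :: (erphp_var, 'a::field) pcr_poly)
    (336 * k * (n * (k - 1)) ^ j - 168 * k)"
  using a
proof (induction j arbitrary: a)
  case 0
  then show ?case using derives_leaf[of k a n, where 'a='a] k by (auto elim: derives_mono)
next
  case (Suc j)
  define t where "t = 336 * k * (n * (k - 1)) ^ j - 168 * k"
  have "derives (erphp_vars k n) (erphp k n) (node_poly a :: (erphp_var, 'a) pcr_poly)
      (n * (k - 1) * t + 42 * n * k ^ 2)"
    using Suc by (intro derives_node[OF k n]) (auto simp: t_def)
  moreover have "n * (k - 1) * t + 42 * n * k ^ 2 \<le> 336 * k * (n * (k - 1)) ^ Suc j - 168 * k"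
  proof -
    define N where "N = n * (k - 1)"
    have N1: "1 \<le> N ^ j" using k n by (simp add: N_def)
    have t: "t + 168 * k \<le> 336 * k * N ^ j" using N1 by (auto simp: t_def N_def)
    obtain i where i: "k = i + 4" using k by (metis add.commute le_add_diff_inverse)
    obtain m where m: "n = m + 4" using n by (metis add.commute le_add_diff_inverse)
    have "42 * n * k ^ 2 + 168 * k \<le> N * (168 * k)"
      by (simp add: N_def i m algebra_simps power2_eq_square)
    then have "N * t + 42 * n * k ^ 2 + 168 * k \<le> N * (t + 168 * k)" by (simp add: algebra_simps)
    also have "\<dots> \<le> N * (336 * k * N ^ j)" by (rule mult_le_mono2[OF t])
    also have "\<dots> = 336 * k * N ^ Suc j" by simp
    finally have "N * t + 42 * n * k ^ 2 \<le> 336 * k * N ^ Suc j - 168 * k" by linarith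
    then show ?thesis unfolding N_def .
  qed
  ultimately show ?case by (rule derives_mono)
qed

text \<open>The root of the tree is the empty list, whose monomial is 1.\<close>

lemma erphp_refutation:
  assumes "4 \<le> k" "4 \<le> n"
  shows "\<exists>\<pi> :: (erphp_var, 'a::field) pcr_poly list.
    pcr_refutation (erphp_vars k n) (erphp k n) \<pi> \<and> pcr_size \<pi> \<le> 336 * (k ^ (k + 1) * n ^ k)"
proof -
  have "derives (erphp_vars k n) (erphp k n) (1 :: (erphp_var, 'a) pcr_poly)
      (336 * k * (n * (k - 1)) ^ k - 168 * k)"
    using derives_tree[OF assms, of "[]" k, where 'a='a] by (simp add: node_poly_Nil)
  moreover have "336 * k * (n * (k - 1)) ^ k - 168 * k \<le> 336 * (k ^ (k + 1) * n ^ k)"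
  proof -
    have "336 * k * (n * (k - 1)) ^ k - 168 * k \<le> 336 * k * (n * (k - 1)) ^ k" by (rule diff_le_self)
    also have "\<dots> \<le> 336 * k * (n * k) ^ k" by (intro mult_le_mono2 power_mono) auto
    also have "\<dots> = 336 * (k ^ (k + 1) * n ^ k)" by (simp add: power_mult_distrib)
    finally show ?thesis .
  qed
  ultimately show ?thesis unfolding derives_def pcr_refutation_def by (blast intro: order_trans)
qed

section \<open>Compatible weights on partial injections\<close>

text \<open>A ring-valued analogue of consistent marginal distributions: injectivity is expressed by
  weight 0, consistency by summing over the hole of one further pigeon. \<open>D\<close> lists the
  domains on which this is required, so families can be built domain by domain.\<close>

definition compatible :: "'p set set \<Rightarrow> 'h set \<Rightarrow> (('p \<rightharpoonup> 'h) \<Rightarrow> 'a::comm_ring_1) \<Rightarrow> bool" where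
  "compatible D H \<mu> \<longleftrightarrow>
     (\<forall>\<sigma>. dom \<sigma> \<in> D \<longrightarrow> ran \<sigma> \<subseteq> H \<longrightarrow> \<not> inj_on \<sigma> (dom \<sigma>) \<longrightarrow> \<mu> \<sigma> = 0) \<and>
     (\<forall>\<sigma> a. a \<notin> dom \<sigma> \<longrightarrow> insert a (dom \<sigma>) \<in> D \<longrightarrow> ran \<sigma> \<subseteq> H \<longrightarrow>
        \<mu> \<sigma> = (\<Sum>h\<in>H. \<mu> (\<sigma>(a \<mapsto> h))))"

lemma compatibleI:
  assumes "\<And>\<sigma>. dom \<sigma> \<in> D \<Longrightarrow> ran \<sigma> \<subseteq> H \<Longrightarrow> \<not> inj_on \<sigma> (dom \<sigma>) \<Longrightarrow> \<mu> \<sigma> = 0"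
    and "\<And>\<sigma> a. a \<notin> dom \<sigma> \<Longrightarrow> insert a (dom \<sigma>) \<in> D \<Longrightarrow> ran \<sigma> \<subseteq> H \<Longrightarrow>
        \<mu> \<sigma> = (\<Sum>h\<in>H. \<mu> (\<sigma>(a \<mapsto> h)))"
  shows "compatible D H \<mu>"
  using assms unfolding compatible_def by blast

lemma compatible_noninj:
  "compatible D H \<mu> \<Longrightarrow> dom \<sigma> \<in> D \<Longrightarrow> ran \<sigma> \<subseteq> H \<Longrightarrow> \<not> inj_on \<sigma> (dom \<sigma>) \<Longrightarrow> \<mu> \<sigma> = 0"
  unfolding compatible_def by blast

lemma compatible_marginal:
  "compatible D H \<mu> \<Longrightarrow> a \<notin> dom \<sigma> \<Longrightarrow> insert a (dom \<sigma>) \<in> D \<Longrightarrow> ran \<sigma> \<subseteq> H \<Longrightarrow>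
     \<mu> \<sigma> = (\<Sum>h\<in>H. \<mu> (\<sigma>(a \<mapsto> h)))"
  unfolding compatible_def by blast

lemma compatible_mono: "compatible D H \<mu> \<Longrightarrow> D' \<subseteq> D \<Longrightarrow> compatible D' H \<mu>"
  unfolding compatible_def by blast

lemma compatible_add:
  "compatible D H \<mu> \<Longrightarrow> compatible D H \<nu> \<Longrightarrow> compatible D H (\<lambda>\<sigma>. \<mu> \<sigma> + \<nu> \<sigma>)"
  unfolding compatible_def by (simp add: sum.distrib)

lemma compatible_diff:
  "compatible D H \<mu> \<Longrightarrow> compatible D H \<nu> \<Longrightarrow> compatible D H (\<lambda>\<sigma>. \<mu> \<sigma> - \<nu> \<sigma>)"
  unfolding compatible_def by (simp add: sum_subtractf)

lemma compatible_sum: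
  "(\<And>b. b \<in> I \<Longrightarrow> compatible D H (\<mu> b)) \<Longrightarrow> compatible D H (\<lambda>\<sigma>. \<Sum>b\<in>I. \<mu> b \<sigma>)"
proof (induction I rule: infinite_finite_induct)
  case (insert b I)
  then show ?case by (simp add: compatible_add)
qed (simp_all add: compatible_def)

lemma ran_upd_in: "x \<in> ran (\<sigma>(a \<mapsto> x))"
  by (auto simp: ran_def)

lemma ran_upd_subset: "ran \<sigma> \<subseteq> H \<Longrightarrow> y \<in> H \<Longrightarrow> ran (\<sigma>(a \<mapsto> y)) \<subseteq> H"
  unfolding ran_def by auto

lemma ran_del_subset: "ran \<sigma> \<subseteq> H \<Longrightarrow> ran (\<sigma>(a := None)) \<subseteq> H"
  unfolding ran_def by auto

lemma inj_on_upd_iff: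
  assumes "a \<notin> dom \<sigma>"
  shows "inj_on (\<sigma>(a \<mapsto> y)) (dom (\<sigma>(a \<mapsto> y))) \<longleftrightarrow> inj_on \<sigma> (dom \<sigma>) \<and> y \<notin> ran \<sigma>"
proof -
  have "dom (\<sigma>(a \<mapsto> y)) = insert a (dom \<sigma>)" by simp
  moreover have "inj_on (\<sigma>(a \<mapsto> y)) (dom \<sigma>) = inj_on \<sigma> (dom \<sigma>)"
    using assms by (intro inj_on_cong) auto
  moreover have "(\<sigma>(a \<mapsto> y)) ` (dom \<sigma> - {a}) = \<sigma> ` dom \<sigma>"
    using assms by (intro image_cong) auto
  moreover have "Some y \<in> \<sigma> ` dom \<sigma> \<longleftrightarrow> y \<in> ran \<sigma>"
    unfolding ran_def image_def by (auto dest: sym)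
  ultimately show ?thesis by auto
qed

section \<open>Adding a hole, adding a pigeon, and conditioning on one placement\<close>

text \<open>Hole \<open>y\<close> is added by giving weight 0 to all maps that use it; in each
  marginal sum the summand for \<open>y\<close> then vanishes.\<close>

lemma compatible_lift:
  assumes "compatible D (H - {y}) \<nu>" "finite H"
  shows "compatible D H (\<lambda>\<sigma>. if y \<in> ran \<sigma> then 0 else \<nu> \<sigma>)"
proof (rule compatibleI)
  fix \<sigma> assume "dom \<sigma> \<in> D" "ran \<sigma> \<subseteq> H" "\<not> inj_on \<sigma> (dom \<sigma>)"
  then show "(if y \<in> ran \<sigma> then 0 else \<nu> \<sigma>) = 0"
    using compatible_noninj[OF assms(1), of \<sigma>] by auto
next
  fix \<sigma> a assume a: "a \<notin> dom \<sigma>" "insert a (dom \<sigma>) \<in> D" "ran \<sigma> \<subseteq> H"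
  show "(if y \<in> ran \<sigma> then 0 else \<nu> \<sigma>) =
      (\<Sum>h\<in>H. if y \<in> ran (\<sigma>(a \<mapsto> h)) then 0 else \<nu> (\<sigma>(a \<mapsto> h)))"
  proof (cases "y \<in> ran \<sigma>")
    case True
    then have "y \<in> ran (\<sigma>(a \<mapsto> h))" for h using a(1) by (auto simp: domIff)
    then show ?thesis using True by simp
  next
    case False
    have "y \<in> ran (\<sigma>(a \<mapsto> h)) \<longleftrightarrow> h = y" for h using a(1) False by (auto simp: domIff)
    moreover have "(\<Sum>h\<in>H. if h = y then 0 else \<nu> (\<sigma>(a \<mapsto> h))) = (\<Sum>h\<in>H-{y}. \<nu> (\<sigma>(a \<mapsto> h)))"
      using assms(2) by (intro sum.mono_neutral_cong_right) auto
    moreover have "\<nu> \<sigma> = (\<Sum>h\<in>H-{y}. \<nu> (\<sigma>(a \<mapsto> h)))"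
      using False a by (intro compatible_marginal[OF assms(1)]) auto
    ultimately show ?thesis using False by simp
  qed
qed

text \<open>Extends a family by sending pigeon \<open>b\<close> to hole \<open>y\<close> with all
  its weight, so that summing over the hole of \<open>b\<close> gives back
  \<open>\<kappa>\<close>.\<close>

definition place :: "'p \<Rightarrow> 'h \<Rightarrow> (('p \<rightharpoonup> 'h) \<Rightarrow> 'a::comm_ring_1) \<Rightarrow> ('p \<rightharpoonup> 'h) \<Rightarrow> 'a" where
  "place b y \<kappa> \<sigma> =
     (if b \<notin> dom \<sigma> then \<kappa> \<sigma> else if \<sigma> b = Some y then \<kappa> (\<sigma>(b := None)) else 0)"

text \<open>The assumption \<open>zero\<close> protects injectivity: a map that sends both
  \<open>b\<close> and some other pigeon to \<open>y\<close> inherits the weight of a map using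
  \<open>y\<close>.\<close>

lemma compatible_place:
  assumes \<kappa>: "compatible (Pow (A - {b})) H \<kappa>" and y: "y \<in> H" and fin: "finite H"
    and zero: "\<And>\<sigma>. dom \<sigma> \<subseteq> A - {b} \<Longrightarrow> ran \<sigma> \<subseteq> H \<Longrightarrow> y \<in> ran \<sigma> \<Longrightarrow> \<kappa> \<sigma> = 0"
  shows "compatible (Pow A) H (place b y \<kappa>)"
proof (rule compatibleI)
  fix \<sigma> assume \<sigma>: "dom \<sigma> \<in> Pow A" "ran \<sigma> \<subseteq> H" "\<not> inj_on \<sigma> (dom \<sigma>)"
  show "place b y \<kappa> \<sigma> = 0"
  proof (cases "\<sigma> b = Some y")
    case True
    define \<tau> where "\<tau> = \<sigma>(b := None)"
    have s: "\<sigma> = \<tau>(b \<mapsto> y)" using True by (auto simp: \<tau>_def)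
    have t: "b \<notin> dom \<tau>" "dom \<tau> \<subseteq> A - {b}" "ran \<tau> \<subseteq> H"
      using \<sigma> by (auto simp: \<tau>_def intro!: ran_del_subset)
    have "\<not> inj_on \<tau> (dom \<tau>) \<or> y \<in> ran \<tau>" using \<sigma>(3) inj_on_upd_iff[OF t(1)] s by metis
    then have "\<kappa> \<tau> = 0" using zero[of \<tau>] compatible_noninj[OF \<kappa>, of \<tau>] t by auto
    then show ?thesis using True by (auto simp: place_def \<tau>_def)
  next
    case False
    then show ?thesis using \<sigma> compatible_noninj[OF \<kappa>, of \<sigma>] by (auto simp: place_def)
  qed
next
  fix \<sigma> a assume a: "a \<notin> dom \<sigma>" "insert a (dom \<sigma>) \<in> Pow A" "ran \<sigma> \<subseteq> H"
  show "place b y \<kappa> \<sigma> = (\<Sum>h\<in>H. place b y \<kappa> (\<sigma>(a \<mapsto> h)))"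
  proof (cases "a = b")
    case True
    have "(\<Sum>h\<in>H. place b y \<kappa> (\<sigma>(a \<mapsto> h))) = (\<Sum>h\<in>H. if h = y then \<kappa> \<sigma> else 0)"
      using True a(1) by (intro sum.cong) (auto simp: place_def domIff fun_upd_idem)
    then show ?thesis using True a(1) y fin by (simp add: place_def)
  next
    case ab: False
    show ?thesis
    proof (cases "\<sigma> b = Some y")
      case True
      define \<tau> where "\<tau> = \<sigma>(b := None)"
      have t: "a \<notin> dom \<tau>" "insert a (dom \<tau>) \<subseteq> A - {b}" "ran \<tau> \<subseteq> H"
        using a ab by (auto simp: \<tau>_def intro!: ran_del_subset)
      have "(\<sigma>(a \<mapsto> h))(b := None) = \<tau>(a \<mapsto> h)" for h using ab by (auto simp: \<tau>_def)
      then show ?thesis using True ab compatible_marginal[OF \<kappa>, of a \<tau>] t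
        by (auto simp: place_def \<tau>_def)
    next
      case False
      then show ?thesis using ab a compatible_marginal[OF \<kappa>, of a \<sigma>] by (auto simp: place_def)
    qed
  qed
qed

text \<open>Conditioning on \<open>b\<close> sitting in \<open>y\<close> removes one pigeon and one
  hole: a further pigeon in \<open>y\<close> would violate injectivity, so its summand is 0.\<close>

lemma compatible_slice:
  assumes "compatible {B. B \<subset> A} H \<mu>" "b \<in> A" "y \<in> H" "finite H"
  shows "compatible {B. B \<subset> A - {b}} (H - {y}) (\<lambda>\<sigma>. \<mu> (\<sigma>(b \<mapsto> y)))"
proof (rule compatibleI)
  fix \<sigma> assume s: "dom \<sigma> \<in> {B. B \<subset> A - {b}}" "ran \<sigma> \<subseteq> H - {y}" "\<not> inj_on \<sigma> (dom \<sigma>)"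
  have b: "b \<notin> dom \<sigma>" using s by auto
  show "\<mu> (\<sigma>(b \<mapsto> y)) = 0"
  proof (rule compatible_noninj[OF assms(1)])
    show "dom (\<sigma>(b \<mapsto> y)) \<in> {B. B \<subset> A}" using s assms(2) by auto
    show "ran (\<sigma>(b \<mapsto> y)) \<subseteq> H" using s assms(3) b by auto
    show "\<not> inj_on (\<sigma>(b \<mapsto> y)) (dom (\<sigma>(b \<mapsto> y)))" using s(3) inj_on_upd_iff[OF b] by blast
  qed
next
  fix \<sigma> a assume a: "a \<notin> dom \<sigma>" "insert a (dom \<sigma>) \<in> {B. B \<subset> A - {b}}" "ran \<sigma> \<subseteq> H - {y}"
  have b: "b \<notin> dom \<sigma>" "a \<noteq> b" using a by auto
  have dm: "insert a (insert b (dom \<sigma>)) \<subset> A" using a assms(2) by auto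
  have "\<mu> (\<sigma>(b \<mapsto> y)) = (\<Sum>h\<in>H. \<mu> (\<sigma>(b \<mapsto> y, a \<mapsto> h)))"
    using a b dm assms by (intro compatible_marginal[OF assms(1)] ran_upd_subset) auto
  also have "\<dots> = (\<Sum>h\<in>H-{y}. \<mu> (\<sigma>(a \<mapsto> h, b \<mapsto> y)))"
  proof (rule sum.mono_neutral_cong_right)
    show "\<forall>i\<in>H - (H - {y}). \<mu> (\<sigma>(b \<mapsto> y, a \<mapsto> i)) = 0"
    proof
      fix i assume "i \<in> H - (H - {y})"
      then have i: "i = y" by auto
      have "\<not> inj_on (\<sigma>(b \<mapsto> y, a \<mapsto> y)) (dom (\<sigma>(b \<mapsto> y, a \<mapsto> y)))"
        using a b by (subst inj_on_upd_iff) (auto intro: ran_upd_in)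
      moreover have "ran (\<sigma>(b \<mapsto> y, a \<mapsto> y)) \<subseteq> H"
        using a assms(3) by (intro ran_upd_subset) auto
      ultimately show "\<mu> (\<sigma>(b \<mapsto> y, a \<mapsto> i)) = 0"
        unfolding i using dm by (intro compatible_noninj[OF assms(1)]) auto
    qed
  qed (use assms b in \<open>auto simp: fun_upd_twist\<close>)
  finally show "\<mu> (\<sigma>(b \<mapsto> y)) = (\<Sum>h\<in>H-{y}. \<mu> (\<sigma>(a \<mapsto> h, b \<mapsto> y)))" .
qed

text \<open>
  Hole \<open>z\<close> is made free by first extending the parts in which some pigeon sits in \<open>z\<close>. Then one
  pigeon \<open>a\<close> is fixed and the family is matched on all domains containing \<open>a\<close>. What remains lives
  on the single domain \<open>A - {a}\<close> and has vanishing marginals, so it extends by putting \<open>a\<close> into \<open>z\<close>.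
\<close>

lemma compatible_extend:
  fixes \<mu> :: "('p \<rightharpoonup> 'h) \<Rightarrow> 'a::comm_ring_1"
  assumes "finite A" "finite H" "2 * card A \<le> card H" "compatible {B. B \<subset> A} H \<mu>"
  shows "\<exists>\<mu>'. compatible (Pow A) H \<mu>' \<and> (\<forall>\<sigma>. dom \<sigma> \<subset> A \<longrightarrow> ran \<sigma> \<subseteq> H \<longrightarrow> \<mu>' \<sigma> = \<mu> \<sigma>)"
  using assms
proof (induction "card A" arbitrary: A H \<mu> rule: less_induct)
  case less
  show ?case
  proof (cases "A = {}")
    case True
    then show ?thesis by (intro exI[of _ \<mu>]) (auto simp: compatible_def)
  next
    case False
    then obtain a where a: "a \<in> A" by blast
    have cA: "card A > 0" using False less.prems(1) by (simp add: card_gt_0_iff)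
    \<comment> \<open>The part of a family with \<open>b\<close> in \<open>y\<close> is conditioned
      on this placement, extended to \<open>A - {b}\<close> by the induction hypothesis, and
      \<open>b\<close> is put back into \<open>y\<close>. The induction needs
      \<open>2 * (card A - 1) \<le> card G - 1\<close>, so one hole less than in the lemma is
      enough.\<close>
    have slice: "\<exists>\<xi>. compatible (Pow A) G \<xi> \<and>
        (\<forall>\<sigma>. dom \<sigma> \<subset> A \<longrightarrow> ran \<sigma> \<subseteq> G \<longrightarrow> \<sigma> b = Some y \<longrightarrow> \<xi> \<sigma> = \<nu> \<sigma>) \<and>
        (\<forall>\<sigma>. b \<in> dom \<sigma> \<longrightarrow> \<sigma> b \<noteq> Some y \<longrightarrow> \<xi> \<sigma> = 0) \<and>
        (\<forall>\<sigma>. y \<in> ran \<sigma> \<longrightarrow> \<sigma> b \<noteq> Some y \<longrightarrow> \<xi> \<sigma> = 0)"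
      if b: "b \<in> A" and y: "y \<in> G" and G: "finite G" "2 * card A \<le> card G + 1"
        and \<nu>: "compatible {B. B \<subset> A} G \<nu>" for b y G and \<nu> :: "('p \<rightharpoonup> 'h) \<Rightarrow> 'a"
    proof -
      have "\<exists>\<nu>'. compatible (Pow (A - {b})) (G - {y}) \<nu>' \<and>
          (\<forall>\<sigma>. dom \<sigma> \<subset> A - {b} \<longrightarrow> ran \<sigma> \<subseteq> G - {y} \<longrightarrow> \<nu>' \<sigma> = \<nu> (\<sigma>(b \<mapsto> y)))"
        using b y G less.prems(1) cA compatible_slice[OF \<nu> b y G(1)]
        by (intro less.hyps) (auto simp: card_Diff_singleton)
      then obtain \<nu>' where \<nu>': "compatible (Pow (A - {b})) (G - {y}) \<nu>'"
        "\<And>\<sigma>. dom \<sigma> \<subset> A - {b} \<Longrightarrow> ran \<sigma> \<subseteq> G - {y} \<Longrightarrow> \<nu>' \<sigma> = \<nu> (\<sigma>(b \<mapsto> y))" by blast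
      define \<kappa> where "\<kappa> = (\<lambda>\<sigma>. if y \<in> ran \<sigma> then 0 else \<nu>' \<sigma>)"
      have "compatible (Pow (A - {b})) G \<kappa>" unfolding \<kappa>_def
        by (rule compatible_lift[OF \<nu>'(1) G(1)])
      then have "compatible (Pow A) G (place b y \<kappa>)"
        by (rule compatible_place) (auto simp: \<kappa>_def y G)
      moreover have "place b y \<kappa> \<sigma> = \<nu> \<sigma>"
        if s: "dom \<sigma> \<subset> A" "ran \<sigma> \<subseteq> G" "\<sigma> b = Some y" for \<sigma>
      proof -
        define \<tau> where "\<tau> = \<sigma>(b := None)"
        have st: "\<sigma> = \<tau>(b \<mapsto> y)" using s by (auto simp: \<tau>_def)
        have t: "b \<notin> dom \<tau>" "dom \<tau> \<subset> A - {b}" "ran \<tau> \<subseteq> G"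
          using s by (auto simp: \<tau>_def intro!: ran_del_subset)
        have p: "place b y \<kappa> \<sigma> = \<kappa> \<tau>" using s by (auto simp: place_def \<tau>_def)
        show ?thesis
        proof (cases "y \<in> ran \<tau>")
          case True
          then have "\<not> inj_on \<sigma> (dom \<sigma>)" using inj_on_upd_iff[OF t(1)] st by metis
          then have "\<nu> \<sigma> = 0" using s by (intro compatible_noninj[OF \<nu>]) auto
          then show ?thesis using True p by (simp add: \<kappa>_def)
        next
          case False
          then have "\<nu>' \<tau> = \<nu> \<sigma>" using t by (subst \<nu>'(2)) (auto simp: st)
          then show ?thesis using False p by (simp add: \<kappa>_def)
        qed
      qed
      moreover have "place b y \<kappa> \<sigma> = 0" if "b \<in> dom \<sigma>" "\<sigma> b \<noteq> Some y" for \<sigma>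
        using that by (auto simp: place_def)
      moreover have "place b y \<kappa> \<sigma> = 0" if "y \<in> ran \<sigma>" "\<sigma> b \<noteq> Some y" for \<sigma>
        using that by (auto simp: place_def \<kappa>_def)
      ultimately show ?thesis by blast
    qed
    have "H \<noteq> {}" using less.prems cA by auto
    then obtain z where z: "z \<in> H" by blast
    have "\<forall>b\<in>A. \<exists>\<xi>. compatible (Pow A) H \<xi> \<and>
        (\<forall>\<sigma>. dom \<sigma> \<subset> A \<longrightarrow> ran \<sigma> \<subseteq> H \<longrightarrow> \<sigma> b = Some z \<longrightarrow> \<xi> \<sigma> = \<mu> \<sigma>) \<and>
        (\<forall>\<sigma>. z \<in> ran \<sigma> \<longrightarrow> \<sigma> b \<noteq> Some z \<longrightarrow> \<xi> \<sigma> = 0)"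
      using slice[OF _ z less.prems(2) _ less.prems(4)] less.prems(3) by (meson le_add1 le_trans)
    then obtain L where L: "\<And>b. b \<in> A \<Longrightarrow> compatible (Pow A) H (L b)"
      "\<And>b \<sigma>. b \<in> A \<Longrightarrow> dom \<sigma> \<subset> A \<Longrightarrow> ran \<sigma> \<subseteq> H \<Longrightarrow> \<sigma> b = Some z \<Longrightarrow> L b \<sigma> = \<mu> \<sigma>"
      "\<And>b \<sigma>. b \<in> A \<Longrightarrow> z \<in> ran \<sigma> \<Longrightarrow> \<sigma> b \<noteq> Some z \<Longrightarrow> L b \<sigma> = 0"
      by metis
    define \<xi>\<^sub>1 where "\<xi>\<^sub>1 = (\<lambda>\<sigma>. \<Sum>b\<in>A. L b \<sigma>)"
    have \<xi>\<^sub>1: "compatible (Pow A) H \<xi>\<^sub>1" unfolding \<xi>\<^sub>1_def by (rule compatible_sum[OF L(1)])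
    define \<mu>\<^sub>1 where "\<mu>\<^sub>1 = (\<lambda>\<sigma>. \<mu> \<sigma> - \<xi>\<^sub>1 \<sigma>)"
    have sub: "{B. B \<subset> A} \<subseteq> Pow A" by auto
    have \<mu>\<^sub>1: "compatible {B. B \<subset> A} H \<mu>\<^sub>1" unfolding \<mu>\<^sub>1_def
      by (rule compatible_diff[OF less.prems(4) compatible_mono[OF \<xi>\<^sub>1 sub]])
    have \<mu>\<^sub>1z: "\<mu>\<^sub>1 \<sigma> = 0" if s: "dom \<sigma> \<subset> A" "ran \<sigma> \<subseteq> H" "z \<in> ran \<sigma>" for \<sigma>
    proof (cases "inj_on \<sigma> (dom \<sigma>)")
      case True
      obtain b where b: "\<sigma> b = Some z" using s(3) by (auto simp: ran_def)
      then have bA: "b \<in> A" using s by auto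
      \<comment> \<open>By injectivity exactly one pigeon \<open>b\<close> sits in \<open>z\<close>,
        so in the sum over all pigeons only \<open>L b\<close> contributes.\<close>
      have "L c \<sigma> = (if c = b then \<mu> \<sigma> else 0)" if "c \<in> A" for c
      proof (cases "c = b")
        case False
        then have "\<sigma> c \<noteq> Some z" using True b by (metis domI inj_onD)
        then show ?thesis using L(3)[OF that s(3)] False by simp
      qed (use L(2) bA b s in auto)
      then have "\<xi>\<^sub>1 \<sigma> = (\<Sum>c\<in>A. if c = b then \<mu> \<sigma> else 0)" unfolding \<xi>\<^sub>1_def by (intro sum.cong) auto
      then show ?thesis using bA less.prems(1) by (simp add: \<mu>\<^sub>1_def)
    next
      case False
      then show ?thesis using s by (intro compatible_noninj[OF \<mu>\<^sub>1]) auto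
    qed
    \<comment> \<open>Giving up \<open>z\<close> uses the one hole of slack allowed in
      \<open>slice\<close>.\<close>
    define G where "G = H - {z}"
    have G: "finite G" "2 * card A \<le> card G + 1" "G \<subseteq> H"
      using less.prems z by (auto simp: G_def card_Diff_singleton)
    have \<mu>\<^sub>1G: "compatible {B. B \<subset> A} G \<mu>\<^sub>1"
    proof (rule compatibleI)
      fix \<sigma> c assume c: "c \<notin> dom \<sigma>" "insert c (dom \<sigma>) \<in> {B. B \<subset> A}" "ran \<sigma> \<subseteq> G"
      have "\<mu>\<^sub>1 \<sigma> = (\<Sum>h\<in>H. \<mu>\<^sub>1 (\<sigma>(c \<mapsto> h)))"
        using c G by (intro compatible_marginal[OF \<mu>\<^sub>1]) auto
      also have "\<dots> = (\<Sum>h\<in>G. \<mu>\<^sub>1 (\<sigma>(c \<mapsto> h)))"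
      proof (rule sum.mono_neutral_right)
        show "\<forall>i\<in>H - G. \<mu>\<^sub>1 (\<sigma>(c \<mapsto> i)) = 0"
        proof
          fix i assume "i \<in> H - G"
          then have "i = z" by (auto simp: G_def)
          moreover have "ran (\<sigma>(c \<mapsto> z)) \<subseteq> H" using c G z by (intro ran_upd_subset) auto
          ultimately show "\<mu>\<^sub>1 (\<sigma>(c \<mapsto> i)) = 0"
            using c by (intro \<mu>\<^sub>1z) (auto intro: ran_upd_in)
        qed
      qed (use G less.prems in auto)
      finally show "\<mu>\<^sub>1 \<sigma> = (\<Sum>h\<in>G. \<mu>\<^sub>1 (\<sigma>(c \<mapsto> h)))" .
    qed (use G in \<open>auto intro!: compatible_noninj[OF \<mu>\<^sub>1]\<close>)
    have "\<forall>y\<in>G. \<exists>\<xi>. compatible (Pow A) G \<xi> \<and>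
        (\<forall>\<sigma>. dom \<sigma> \<subset> A \<longrightarrow> ran \<sigma> \<subseteq> G \<longrightarrow> \<sigma> a = Some y \<longrightarrow> \<xi> \<sigma> = \<mu>\<^sub>1 \<sigma>) \<and>
        (\<forall>\<sigma>. a \<in> dom \<sigma> \<longrightarrow> \<sigma> a \<noteq> Some y \<longrightarrow> \<xi> \<sigma> = 0)"
      using slice[OF a _ G(1,2) \<mu>\<^sub>1G] by meson
    then obtain M where M: "\<And>y. y \<in> G \<Longrightarrow> compatible (Pow A) G (M y)"
      "\<And>y \<sigma>. y \<in> G \<Longrightarrow> dom \<sigma> \<subset> A \<Longrightarrow> ran \<sigma> \<subseteq> G \<Longrightarrow> \<sigma> a = Some y \<Longrightarrow> M y \<sigma> = \<mu>\<^sub>1 \<sigma>"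
      "\<And>y \<sigma>. y \<in> G \<Longrightarrow> a \<in> dom \<sigma> \<Longrightarrow> \<sigma> a \<noteq> Some y \<Longrightarrow> M y \<sigma> = 0"
      by metis
    define \<xi>\<^sub>2 where "\<xi>\<^sub>2 = (\<lambda>\<sigma>. if z \<in> ran \<sigma> then 0 else \<Sum>y\<in>G. M y \<sigma>)"
    have \<xi>\<^sub>2: "compatible (Pow A) H \<xi>\<^sub>2" unfolding \<xi>\<^sub>2_def
      using compatible_sum[of G "Pow A" G M] M(1) less.prems(2)
      by (intro compatible_lift) (auto simp: G_def)
    \<comment> \<open>For given \<open>\<sigma>\<close> exactly one summand \<open>M y\<close> is
      non-trivial, the one where \<open>y\<close> is the hole of \<open>a\<close>; maps using
      \<open>z\<close> have weight 0 on both sides.\<close>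
    have \<xi>\<^sub>2a: "\<xi>\<^sub>2 \<sigma> = \<mu>\<^sub>1 \<sigma>" if s: "dom \<sigma> \<subset> A" "ran \<sigma> \<subseteq> H" "a \<in> dom \<sigma>" for \<sigma>
    proof (cases "z \<in> ran \<sigma>")
      case False
      then have r: "ran \<sigma> \<subseteq> G" using s by (auto simp: G_def)
      obtain y where y: "\<sigma> a = Some y" using s by auto
      then have "y \<in> G" using r by (auto simp: ran_def)
      have "M x \<sigma> = (if x = y then \<mu>\<^sub>1 \<sigma> else 0)" if "x \<in> G" for x
        using M(2)[OF that s(1) r] M(3)[OF that s(3)] y by auto
      then have "(\<Sum>x\<in>G. M x \<sigma>) = (\<Sum>x\<in>G. if x = y then \<mu>\<^sub>1 \<sigma> else 0)" by (intro sum.cong) auto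
      then show ?thesis using \<open>y \<in> G\<close> G(1) False by (simp add: \<xi>\<^sub>2_def)
    qed (use \<mu>\<^sub>1z s in \<open>simp add: \<xi>\<^sub>2_def\<close>)
    define \<mu>\<^sub>2 where "\<mu>\<^sub>2 = (\<lambda>\<sigma>. \<mu>\<^sub>1 \<sigma> - \<xi>\<^sub>2 \<sigma>)"
    have \<mu>\<^sub>2: "compatible {B. B \<subset> A} H \<mu>\<^sub>2" unfolding \<mu>\<^sub>2_def
      by (rule compatible_diff[OF \<mu>\<^sub>1 compatible_mono[OF \<xi>\<^sub>2 sub]])
    \<comment> \<open>If \<open>a\<close> is not in the domain, the weight is a sum over the holes
      of \<open>a\<close>, and every summand is already known to be 0.\<close>
    have \<mu>\<^sub>2a: "\<mu>\<^sub>2 \<sigma> = 0" if s: "insert a (dom \<sigma>) \<subset> A" "ran \<sigma> \<subseteq> H" for \<sigma>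
    proof (cases "a \<in> dom \<sigma>")
      case True
      then show ?thesis using \<xi>\<^sub>2a[of \<sigma>] s by (simp add: \<mu>\<^sub>2_def insert_absorb)
    next
      case False
      have "\<mu>\<^sub>2 \<sigma> = (\<Sum>h\<in>H. \<mu>\<^sub>2 (\<sigma>(a \<mapsto> h)))"
        using s False by (intro compatible_marginal[OF \<mu>\<^sub>2]) auto
      also have "\<dots> = 0"
      proof (rule sum.neutral, rule ballI)
        fix h assume "h \<in> H"
        then have "ran (\<sigma>(a \<mapsto> h)) \<subseteq> H" using s by (intro ran_upd_subset) auto
        then show "\<mu>\<^sub>2 (\<sigma>(a \<mapsto> h)) = 0" using \<xi>\<^sub>2a[of "\<sigma>(a \<mapsto> h)"] s by (auto simp: \<mu>\<^sub>2_def)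
      qed
      finally show ?thesis .
    qed
    have "compatible (Pow (A - {a})) H \<mu>\<^sub>2"
      using a by (intro compatible_mono[OF \<mu>\<^sub>2]) auto
    then have \<xi>\<^sub>3: "compatible (Pow A) H (place a z \<mu>\<^sub>2)"
    proof (rule compatible_place)
      fix \<sigma> assume s: "dom \<sigma> \<subseteq> A - {a}" "ran \<sigma> \<subseteq> H" "z \<in> ran \<sigma>"
      then have "dom \<sigma> \<subset> A" using a by auto
      then show "\<mu>\<^sub>2 \<sigma> = 0" using \<mu>\<^sub>1z s by (simp add: \<mu>\<^sub>2_def \<xi>\<^sub>2_def)
    qed (use z less.prems in auto)
    have \<xi>\<^sub>3a: "place a z \<mu>\<^sub>2 \<sigma> = \<mu>\<^sub>2 \<sigma>" if s: "dom \<sigma> \<subset> A" "ran \<sigma> \<subseteq> H" for \<sigma>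
    proof (cases "a \<in> dom \<sigma>")
      case True
      have d: "insert a (dom (\<sigma>(a := None))) = dom \<sigma>" using True by auto
      have r: "ran (\<sigma>(a := None)) \<subseteq> H" using s by (intro ran_del_subset) auto
      have "\<mu>\<^sub>2 (\<sigma>(a := None)) = 0" using d r s by (intro \<mu>\<^sub>2a) auto
      moreover have "\<mu>\<^sub>2 \<sigma> = 0" using True s by (intro \<mu>\<^sub>2a) (auto simp: insert_absorb)
      ultimately show ?thesis by (simp add: place_def)
    qed (simp add: place_def)
    \<comment> \<open>On proper subsets of \<open>A\<close> the sum telescopes: \<open>\<mu>\<close>
      is \<open>\<xi>\<^sub>1\<close> plus \<open>\<mu>\<^sub>1\<close>, and
      \<open>\<mu>\<^sub>1\<close> is \<open>\<xi>\<^sub>2\<close> plus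
      \<open>\<mu>\<^sub>2\<close>, which the third summand reproduces.\<close>
    define \<mu>' where "\<mu>' = (\<lambda>\<sigma>. \<xi>\<^sub>1 \<sigma> + \<xi>\<^sub>2 \<sigma> + place a z \<mu>\<^sub>2 \<sigma>)"
    have "compatible (Pow A) H \<mu>'" unfolding \<mu>'_def by (intro compatible_add \<xi>\<^sub>1 \<xi>\<^sub>2 \<xi>\<^sub>3)
    moreover have "\<mu>' \<sigma> = \<mu> \<sigma>" if "dom \<sigma> \<subset> A" "ran \<sigma> \<subseteq> H" for \<sigma>
      using \<xi>\<^sub>3a[OF that] by (simp add: \<mu>'_def \<mu>\<^sub>2_def \<mu>\<^sub>1_def)
    ultimately show ?thesis by blast
  qed
qed

section \<open>Extending weights to many domains\<close>

text \<open>All proper subsets of a new domain are old, so new domains are never nested and each can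
  be extended on its own without conflict.\<close>

lemma compatible_extend_family:
  fixes \<mu> :: "('p \<rightharpoonup> 'h) \<Rightarrow> 'a::comm_ring_1"
  assumes \<mu>: "compatible D H \<mu>" and fin: "finite H"
    and down: "\<And>A B. A \<in> D \<Longrightarrow> B \<subset> A \<Longrightarrow> B \<in> D"
    and new: "\<And>A. A \<in> D' - D \<Longrightarrow> finite A \<and> 2 * card A \<le> card H \<and> {B. B \<subset> A} \<subseteq> D"
  shows "\<exists>\<mu>'. compatible D' H \<mu>' \<and> (\<forall>\<sigma>. dom \<sigma> \<in> D \<longrightarrow> \<mu>' \<sigma> = \<mu> \<sigma>)"
proof -
  have "\<forall>A\<in>D' - D. \<exists>\<mu>'. compatible (Pow A) H \<mu>' \<and>
      (\<forall>\<sigma>. dom \<sigma> \<subset> A \<longrightarrow> ran \<sigma> \<subseteq> H \<longrightarrow> \<mu>' \<sigma> = \<mu> \<sigma>)"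
    using new fin compatible_mono[OF \<mu>] by (intro ballI compatible_extend) auto
  then obtain X where X: "\<And>A. A \<in> D' - D \<Longrightarrow> compatible (Pow A) H (X A)"
    "\<And>A \<sigma>. A \<in> D' - D \<Longrightarrow> dom \<sigma> \<subset> A \<Longrightarrow> ran \<sigma> \<subseteq> H \<Longrightarrow> X A \<sigma> = \<mu> \<sigma>" by metis
  define \<mu>' where "\<mu>' = (\<lambda>\<sigma>. if dom \<sigma> \<in> D then \<mu> \<sigma> else X (dom \<sigma>) \<sigma>)"
  have "compatible D' H \<mu>'"
  proof (rule compatibleI)
    fix \<sigma> assume "dom \<sigma> \<in> D'" "ran \<sigma> \<subseteq> H" "\<not> inj_on \<sigma> (dom \<sigma>)"
    then show "\<mu>' \<sigma> = 0"
      using compatible_noninj[OF \<mu>, of \<sigma>] compatible_noninj[OF X(1), of "dom \<sigma>" \<sigma>]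
      by (cases "dom \<sigma> \<in> D") (simp_all add: \<mu>'_def)
  next
    fix \<sigma> a assume a: "a \<notin> dom \<sigma>" "insert a (dom \<sigma>) \<in> D'" "ran \<sigma> \<subseteq> H"
    have sub: "dom \<sigma> \<subset> insert a (dom \<sigma>)" using a by auto
    show "\<mu>' \<sigma> = (\<Sum>h\<in>H. \<mu>' (\<sigma>(a \<mapsto> h)))"
    proof (cases "insert a (dom \<sigma>) \<in> D")
      case True
      then have "dom \<sigma> \<in> D" using down sub by blast
      then have "\<mu>' \<sigma> = \<mu> \<sigma>" by (simp add: \<mu>'_def)
      also have "\<dots> = (\<Sum>h\<in>H. \<mu> (\<sigma>(a \<mapsto> h)))" by (rule compatible_marginal[OF \<mu> a(1) True a(3)])
      finally show ?thesis using True by (simp add: \<mu>'_def)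
    next
      case False
      then have A: "insert a (dom \<sigma>) \<in> D' - D" using a by auto
      then have "dom \<sigma> \<in> D" using new[OF A] sub by blast
      then have "\<mu>' \<sigma> = X (insert a (dom \<sigma>)) \<sigma>" using X(2)[OF A sub a(3)] by (simp add: \<mu>'_def)
      also have "\<dots> = (\<Sum>h\<in>H. X (insert a (dom \<sigma>)) (\<sigma>(a \<mapsto> h)))"
        by (rule compatible_marginal[OF X(1)[OF A] a(1) _ a(3)]) simp
      finally show ?thesis using False by (simp add: \<mu>'_def)
    qed
  qed
  then show ?thesis by (intro exI[of _ \<mu>']) (simp add: \<mu>'_def)
qed

text \<open>The domains are added layer by layer, by increasing size, starting from weight 1 on the
  empty map.\<close>

lemma compatible_exists:
  assumes "finite U" "finite H" "2 * e \<le> card H"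
  shows "\<exists>\<mu> :: ('p \<rightharpoonup> 'h) \<Rightarrow> 'a::comm_ring_1.
    compatible {B. B \<subseteq> U \<and> card B \<le> e} H \<mu> \<and> \<mu> Map.empty = 1"
  using assms(3)
proof (induction e)
  case 0
  have "compatible {B. B \<subseteq> U \<and> card B \<le> 0} H (\<lambda>_. 1 :: 'a)"
  proof (rule compatibleI)
    fix \<sigma> :: "'p \<rightharpoonup> 'h" assume "dom \<sigma> \<in> {B. B \<subseteq> U \<and> card B \<le> 0}" "\<not> inj_on \<sigma> (dom \<sigma>)"
    then show "(1 :: 'a) = 0" using assms(1) finite_subset[of "dom \<sigma>" U] by auto
  next
    fix \<sigma> :: "'p \<rightharpoonup> 'h" and a assume "insert a (dom \<sigma>) \<in> {B. B \<subseteq> U \<and> card B \<le> 0}"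
    then show "(1 :: 'a) = (\<Sum>h\<in>H. 1)" using assms(1) finite_subset[of "insert a (dom \<sigma>)" U] by auto
  qed
  then show ?case by blast
next
  case (Suc e)
  then obtain \<mu> :: "('p \<rightharpoonup> 'h) \<Rightarrow> 'a" where \<mu>: "compatible {B. B \<subseteq> U \<and> card B \<le> e} H \<mu>"
    "\<mu> Map.empty = 1" by auto
  have "\<exists>\<mu>'. compatible {B. B \<subseteq> U \<and> card B \<le> Suc e} H \<mu>' \<and>
      (\<forall>\<sigma>. dom \<sigma> \<in> {B. B \<subseteq> U \<and> card B \<le> e} \<longrightarrow> \<mu>' \<sigma> = \<mu> \<sigma>)"
  proof (rule compatible_extend_family[OF \<mu>(1) assms(2)])
    fix A B assume A: "A \<in> {B. B \<subseteq> U \<and> card B \<le> e}" "B \<subset> A"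
    then have "finite A" using assms(1) finite_subset by blast
    then have "card B < card A" using A psubset_card_mono by blast
    then show "B \<in> {B. B \<subseteq> U \<and> card B \<le> e}" using A by auto
  next
    fix A assume A: "A \<in> {B. B \<subseteq> U \<and> card B \<le> Suc e} - {B. B \<subseteq> U \<and> card B \<le> e}"
    then have fA: "finite A" using assms(1) finite_subset by blast
    have cA: "card A = Suc e" "A \<subseteq> U" using A by auto
    have "card B \<le> e" if "B \<subset> A" for B using psubset_card_mono[OF fA that] cA by simp
    then show "finite A \<and> 2 * card A \<le> card H \<and> {B. B \<subset> A} \<subseteq> {B. B \<subseteq> U \<and> card B \<le> e}"
      using fA cA Suc.prems by auto
  qed
  then obtain \<mu>' where \<mu>': "compatible {B. B \<subseteq> U \<and> card B \<le> Suc e} H \<mu>'"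
    "\<And>\<sigma>. dom \<sigma> \<in> {B. B \<subseteq> U \<and> card B \<le> e} \<Longrightarrow> \<mu>' \<sigma> = \<mu> \<sigma>" by blast
  have "\<mu>' Map.empty = 1" using \<mu>'(2)[of Map.empty] \<mu>(2) by simp
  then show ?case using \<mu>'(1) by blast
qed

section \<open>Expectations of polynomials\<close>

definition partial_maps :: "'p set \<Rightarrow> 'h set \<Rightarrow> ('p \<rightharpoonup> 'h) set" where
  "partial_maps A H = {\<sigma>. dom \<sigma> = A \<and> ran \<sigma> \<subseteq> H}"

lemma partial_maps_empty [simp]: "partial_maps {} H = {Map.empty}"
  by (auto simp: partial_maps_def)

lemma sum_partial_maps_insert:
  assumes "a \<notin> A"
  shows "(\<Sum>\<tau>\<in>partial_maps (insert a A) H. f \<tau>) = (\<Sum>\<sigma>\<in>partial_maps A H. \<Sum>h\<in>H. f (\<sigma>(a \<mapsto> h)))"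
    (is "?L = ?R")
proof -
  have "?R = (\<Sum>(\<sigma>, h)\<in>partial_maps A H \<times> H. f (\<sigma>(a \<mapsto> h)))" by (rule sum.cartesian_product)
  also have "\<dots> = ?L"
  proof (rule sum.reindex_bij_witness[where i = "\<lambda>\<tau>. (\<tau>(a := None), the (\<tau> a))"
        and j = "\<lambda>(\<sigma>, h). \<sigma>(a \<mapsto> h)"])
    fix x assume x: "x \<in> partial_maps A H \<times> H"
    obtain \<sigma> h where [simp]: "x = (\<sigma>, h)" by (cases x)
    have "\<sigma> a = None" using x assms by (auto simp: partial_maps_def)
    then show "((case x of (\<sigma>, h) \<Rightarrow> \<sigma>(a \<mapsto> h))(a := None), the ((case x of (\<sigma>, h) \<Rightarrow> \<sigma>(a \<mapsto> h)) a)) = x"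
      by (simp add: fun_upd_idem)
    show "(case x of (\<sigma>, h) \<Rightarrow> \<sigma>(a \<mapsto> h)) \<in> partial_maps (insert a A) H"
      using x by (auto simp: partial_maps_def ran_def)
    show "f (case x of (\<sigma>, h) \<Rightarrow> \<sigma>(a \<mapsto> h)) = (case x of (\<sigma>, h) \<Rightarrow> f (\<sigma>(a \<mapsto> h)))" by simp
  next
    fix \<tau> assume t: "\<tau> \<in> partial_maps (insert a A) H"
    then obtain h where h: "\<tau> a = Some h" by (auto simp: partial_maps_def dom_def)
    then show "(case (\<tau>(a := None), the (\<tau> a)) of (\<sigma>, h) \<Rightarrow> \<sigma>(a \<mapsto> h)) = \<tau>"
      by auto
    show "(\<tau>(a := None), the (\<tau> a)) \<in> partial_maps A H \<times> H"
      using t h assms by (auto simp: partial_maps_def ran_def)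
  qed
  finally show ?thesis by simp
qed

section \<open>Linear functionals on polynomials\<close>

text \<open>The linear functional taking the value \<open>g m\<close> at the monomial
  \<open>m\<close>. Both weighted sums of a line and the extraction of a coefficient are of this
  form.\<close>

definition linear_ext :: "('k \<Rightarrow> 'a) \<Rightarrow> ('k \<Rightarrow>\<^sub>0 'a::comm_ring_1) \<Rightarrow> 'a" where
  "linear_ext g p = (\<Sum>m\<in>Poly_Mapping.keys p. Poly_Mapping.lookup p m * g m)"

lemma linear_ext_superset:
  assumes "finite K" "Poly_Mapping.keys p \<subseteq> K"
  shows "linear_ext g p = (\<Sum>m\<in>K. Poly_Mapping.lookup p m * g m)"
  unfolding linear_ext_def using assms
  by (intro sum.mono_neutral_left) (auto simp: in_keys_iff)

lemma linear_ext_add: "linear_ext g (p + q) = linear_ext g p + linear_ext g q"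
proof -
  let ?K = "Poly_Mapping.keys p \<union> Poly_Mapping.keys q"
  have "finite ?K" by simp
  note ext = linear_ext_superset[OF this]
  have "linear_ext g (p + q) = (\<Sum>m\<in>?K. Poly_Mapping.lookup (p + q) m * g m)"
    by (rule ext[OF Poly_Mapping.keys_add])
  moreover have "linear_ext g p = (\<Sum>m\<in>?K. Poly_Mapping.lookup p m * g m)" by (rule ext) simp
  moreover have "linear_ext g q = (\<Sum>m\<in>?K. Poly_Mapping.lookup q m * g m)" by (rule ext) simp
  ultimately show ?thesis by (simp add: lookup_add distrib_right sum.distrib)
qed

lemma linear_ext_uminus: "linear_ext g (- p) = - linear_ext g p"
  unfolding linear_ext_def by (simp add: sum_negf keys_def)

lemma linear_ext_diff: "linear_ext g (p - q) = linear_ext g p - linear_ext g q"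
  using linear_ext_add[of g p "- q"] by (simp add: linear_ext_uminus)

lemma linear_ext_single: "linear_ext g (Poly_Mapping.single m a) = a * g m"
  unfolding linear_ext_def by simp

text \<open>Multiplication by a monomial shifts the argument of the functional; the terms of
  \<open>p\<close> are added one at a time.\<close>

lemma linear_ext_single_mult:
  fixes p :: "'k::cancel_comm_monoid_add \<Rightarrow>\<^sub>0 'a::comm_ring_1"
  shows "linear_ext g (Poly_Mapping.single m a * p) = a * linear_ext (\<lambda>m'. g (m + m')) p"
proof (induction p rule: update_induct)
  case const
  then show ?case by (simp add: linear_ext_def)
next
  case (update p k b)
  have "Poly_Mapping.update k b p = p + Poly_Mapping.single k b"
    using update(1) by (intro poly_mapping_eqI)
      (auto simp: lookup_update lookup_add lookup_single in_keys_iff when_def)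
  then show ?case using update.IH
    by (simp add: linear_ext_add linear_ext_single distrib_left mult_single mult.assoc)
qed

lemma linear_ext_cong:
  "(\<And>m. m \<in> Poly_Mapping.keys p \<Longrightarrow> g m = g' m) \<Longrightarrow> linear_ext g p = linear_ext g' p"
  unfolding linear_ext_def by (intro sum.cong) simp_all

lemma lookup_eq_linear_ext:
  "Poly_Mapping.lookup p x = linear_ext (\<lambda>m. if m = x then 1 else 0) p"
  unfolding linear_ext_def by (simp add: in_keys_iff if_distrib cong: if_cong)

text \<open>The shift of exponent vectors is injective, so no terms cancel. This lets a bound on the
  terms of a product be used for the terms of the factor.\<close>

lemma keys_lit_mult:
  fixes p :: "('v, 'a::field) pcr_poly"
  assumes "m \<in> Poly_Mapping.keys p"
  shows "Poly_Mapping.single l 1 + m \<in> Poly_Mapping.keys (lit_poly l * p)"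
proof -
  have "Poly_Mapping.lookup (lit_poly l * p) (Poly_Mapping.single l 1 + m) = Poly_Mapping.lookup p m"
    unfolding lookup_eq_linear_ext[of _ "Poly_Mapping.single l 1 + m"] lit_poly_def linear_ext_single_mult
    by (simp add: lookup_eq_linear_ext)
  then show ?thesis using assms by (simp add: in_keys_iff)
qed

lemma keys_add_nat: "Poly_Mapping.keys (a + b :: 'k \<Rightarrow>\<^sub>0 nat) = Poly_Mapping.keys a \<union> Poly_Mapping.keys b"
  by (auto simp: in_keys_iff lookup_add)

lemma clause_poly_single:
  assumes "finite C"
  shows "\<exists>m. (clause_poly C :: ('v, 'a::field) pcr_poly) = Poly_Mapping.single m 1 \<and> Poly_Mapping.keys m = C"
  using assms
proof (induction C rule: finite_induct)
  case empty
  have "clause_poly {} = (Poly_Mapping.single 0 1 :: ('v, 'a) pcr_poly)" by (simp add: clause_poly_def)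
  then show ?case by (intro exI[of _ 0]) simp
next
  case (insert l C)
  then obtain m where m: "(clause_poly C :: ('v, 'a) pcr_poly) = Poly_Mapping.single m 1" "Poly_Mapping.keys m = C"
    by blast
  have "(clause_poly (insert l C) :: ('v, 'a) pcr_poly) = lit_poly l * clause_poly C"
    using insert by (simp add: clause_poly_def)
  also have "\<dots> = Poly_Mapping.single (Poly_Mapping.single l 1 + m) 1"
    by (simp add: m lit_poly_def mult_single)
  finally show ?case using m(2) by (intro exI[of _ "Poly_Mapping.single l 1 + m"]) (simp add: keys_add_nat)
qed

section \<open>Evaluation under a restriction\<close>

text \<open>The place whose choice of hole the variable describes. The other variables get no place
  because a restriction fixes them completely.\<close>

primrec middle :: "erphp_var \<Rightarrow> nat set" where
  "middle (P u v) = {}"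
| "middle (Y u v) = {}"
| "middle (R v) = {}"
| "middle (RR v v') = {}"
| "middle (Q v w) = {v}"
| "middle (Z v w) = {v}"

primrec lit_var :: "'v literal \<Rightarrow> 'v" where
  "lit_var (Pos x) = x"
| "lit_var (Neg x) = x"

text \<open>\<open>s\<close> reserves places for the pigeons and \<open>B\<close> holds the bits of
  the other places. \<open>e\<close> bounds the pigeons a monomial may involve;
  \<open>2 * e \<le> k - 1\<close> is the room that extending weights requires.\<close>

locale restriction =
  fixes k n e :: nat and s :: "nat \<Rightarrow> nat" and B :: "nat set"
  assumes k: "4 \<le> k" and n: "4 \<le> n" and e: "1 \<le> e" "2 * e \<le> k - 1"
    and s_inj: "inj_on s {1..k}" and s_range: "s ` {1..k} \<subseteq> {1..n}"
begin

abbreviation "pigeons \<equiv> {1..k}"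
abbreviation "holes \<equiv> {1..k - 1}"
abbreviation "small \<equiv> {A. A \<subseteq> pigeons \<and> card A \<le> e}"

text \<open>
  Pigeon \<open>u\<close> goes to place \<open>s u\<close>, from there to the hole \<open>\<sigma> u\<close>. Unused places have no guest, and all
  their \<open>Q\<close> and \<open>Z\<close> variables share the value prescribed by \<open>B\<close>, which satisfies their clauses.
\<close>

primrec var_true :: "(nat \<rightharpoonup> nat) \<Rightarrow> erphp_var \<Rightarrow> bool" where
  "var_true \<sigma> (P u v) \<longleftrightarrow> s u = v"
| "var_true \<sigma> (Y u v) \<longleftrightarrow> v < s u"
| "var_true \<sigma> (R v) \<longleftrightarrow> v \<in> s ` pigeons"
| "var_true \<sigma> (RR v v') \<longleftrightarrow> v \<in> s ` pigeons \<and> v' \<in> s ` pigeons"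
| "var_true \<sigma> (Q v w) \<longleftrightarrow> (if v \<in> s ` pigeons then \<exists>u\<in>pigeons. s u = v \<and> \<sigma> u = Some w else v \<in> B)"
| "var_true \<sigma> (Z v w) \<longleftrightarrow>
     (if v \<in> s ` pigeons then \<exists>u\<in>pigeons. s u = v \<and> (\<exists>w'>w. \<sigma> u = Some w') else v \<in> B)"

primrec lit_true :: "(nat \<rightharpoonup> nat) \<Rightarrow> erphp_var literal \<Rightarrow> bool" where
  "lit_true \<sigma> (Pos x) \<longleftrightarrow> var_true \<sigma> x"
| "lit_true \<sigma> (Neg x) \<longleftrightarrow> \<not> var_true \<sigma> x"

text \<open>The pigeons whose holes decide the literal; an empty set means that the restriction
  fixes its value.\<close>

definition lit_pigeons :: "erphp_var literal \<Rightarrow> nat set" where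
  "lit_pigeons l = {u \<in> pigeons. s u \<in> middle (lit_var l)}"

definition pigeons_of :: "(erphp_var literal \<Rightarrow>\<^sub>0 nat) \<Rightarrow> nat set" where
  "pigeons_of m = (\<Union>l\<in>Poly_Mapping.keys m. lit_pigeons l)"

text \<open>Some fixed literal is true, that is 0, so the monomial vanishes. Evaluating at the empty
  map is harmless since a fixed literal does not look at the map.\<close>

definition killed :: "(erphp_var literal \<Rightarrow>\<^sub>0 nat) \<Rightarrow> bool" where
  "killed m \<longleftrightarrow> (\<exists>l\<in>Poly_Mapping.keys m. lit_pigeons l = {} \<and> lit_true Map.empty l)"

definition lit_val :: "(nat \<rightharpoonup> nat) \<Rightarrow> erphp_var literal \<Rightarrow> 'a::field" where
  "lit_val \<sigma> l = (if lit_true \<sigma> l then 0 else 1)"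

definition mon_val :: "(nat \<rightharpoonup> nat) \<Rightarrow> (erphp_var literal \<Rightarrow>\<^sub>0 nat) \<Rightarrow> 'a::field" where
  "mon_val \<sigma> m = (\<Prod>l\<in>Poly_Mapping.keys m. lit_val \<sigma> l)"

text \<open>Only the pigeons of \<open>m\<close> itself are summed over, so that weights on small
  domains suffice.\<close>

definition mon_expect :: "((nat \<rightharpoonup> nat) \<Rightarrow> 'a::field) \<Rightarrow> (erphp_var literal \<Rightarrow>\<^sub>0 nat) \<Rightarrow> 'a" where
  "mon_expect \<mu> m = (\<Sum>\<sigma>\<in>partial_maps (pigeons_of m) holes. mon_val \<sigma> m * \<mu> \<sigma>)"

text \<open>All weights are quantified over because multiplication by a literal leads to other
  weights on the premise.\<close>

definition null :: "(erphp_var, 'a::field) pcr_poly \<Rightarrow> bool" where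
  "null p \<longleftrightarrow> (\<forall>\<mu>. compatible small holes \<mu> \<longrightarrow> linear_ext (mon_expect \<mu>) p = 0)"

lemma lit_true_cong:
  assumes "\<And>u. u \<in> lit_pigeons l \<Longrightarrow> \<sigma> u = \<tau> u"
  shows "lit_true \<sigma> l = lit_true \<tau> l"
proof -
  have "var_true \<sigma> x = var_true \<tau> x" if "\<And>u. u \<in> pigeons \<Longrightarrow> s u \<in> middle x \<Longrightarrow> \<sigma> u = \<tau> u" for x
    using that by (cases x) auto
  then show ?thesis using assms by (cases l) (auto simp: lit_pigeons_def)
qed

lemma lit_val_cong: "(\<And>u. u \<in> lit_pigeons l \<Longrightarrow> \<sigma> u = \<tau> u) \<Longrightarrow> lit_val \<sigma> l = lit_val \<tau> l"
  unfolding lit_val_def using lit_true_cong by metis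

lemma mon_val_cong:
  assumes "\<And>u. u \<in> pigeons_of m \<Longrightarrow> \<sigma> u = \<tau> u"
  shows "mon_val \<sigma> m = mon_val \<tau> m"
  unfolding mon_val_def using assms by (intro prod.cong lit_val_cong) (auto simp: pigeons_of_def)

lemma mon_val_eq_0: "l \<in> Poly_Mapping.keys m \<Longrightarrow> lit_true \<sigma> l \<Longrightarrow> mon_val \<sigma> m = 0"
  unfolding mon_val_def lit_val_def by (intro prod_zero) auto

lemma mon_val_killed: "killed m \<Longrightarrow> mon_val \<sigma> m = 0"
  unfolding killed_def using mon_val_eq_0 lit_true_cong by (metis empty_iff)

lemma mon_expect_killed: "killed m \<Longrightarrow> mon_expect \<mu> m = 0"
  unfolding mon_expect_def by (simp add: mon_val_killed)

text \<open>Literal values are 0 or 1, so a repeated literal is absorbed.\<close>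

lemma mon_val_lit_add:
  "(mon_val \<sigma> (Poly_Mapping.single l 1 + m) :: 'a::field) = lit_val \<sigma> l * mon_val \<sigma> m"
proof (cases "l \<in> Poly_Mapping.keys m")
  case True
  have "lit_val \<sigma> l * lit_val \<sigma> l = (lit_val \<sigma> l :: 'a)" by (simp add: lit_val_def)
  then have "lit_val \<sigma> l * mon_val \<sigma> m = (mon_val \<sigma> m :: 'a)"
    unfolding mon_val_def prod.remove[OF finite_keys True] by (simp flip: mult.assoc)
  then show ?thesis using True by (simp add: mon_val_def keys_add_nat insert_absorb)
next
  case False
  then show ?thesis by (simp add: mon_val_def keys_add_nat)
qed

lemma pigeons_of_lit_add: "pigeons_of (Poly_Mapping.single l 1 + m) = lit_pigeons l \<union> pigeons_of m"
  by (auto simp: pigeons_of_def keys_add_nat)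

lemma pigeons_of_subset: "pigeons_of m \<subseteq> pigeons"
  by (auto simp: pigeons_of_def lit_pigeons_def)

text \<open>A variable concerns at most one place, and by injectivity of \<open>s\<close> that place
  has at most one pigeon.\<close>

lemma lit_pigeons_cases:
  obtains (fixed) "lit_pigeons l = {}" | (free) u where "lit_pigeons l = {u}" "u \<in> pigeons"
proof -
  have uniq: "u = u'" if "u \<in> lit_pigeons l" "u' \<in> lit_pigeons l" for u u'
  proof -
    have "s u = s u'" using that by (cases "lit_var l") (auto simp: lit_pigeons_def)
    then show ?thesis
      by (rule inj_onD[OF s_inj]) (use that in \<open>simp_all add: lit_pigeons_def\<close>)
  qed
  show thesis
  proof (cases "lit_pigeons l = {}")
    case False
    then obtain u where u: "u \<in> lit_pigeons l" by blast
    then have "lit_pigeons l = {u}" using uniq by blast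
    moreover have "u \<in> pigeons" using u unfolding lit_pigeons_def by blast
    ultimately show thesis by (rule free)
  qed (rule fixed)
qed

lemma mon_expect_keys_cong:
  "Poly_Mapping.keys m = Poly_Mapping.keys m' \<Longrightarrow> mon_expect \<mu> m = mon_expect \<mu> m'"
  by (simp add: mon_expect_def mon_val_def pigeons_of_def)

lemma mon_expect_zero: "mon_expect \<mu> 0 = \<mu> Map.empty"
  by (simp add: mon_expect_def pigeons_of_def mon_val_def)

lemma mon_expect_fixed_add:
  fixes \<mu> :: "(nat \<rightharpoonup> nat) \<Rightarrow> 'a::field"
  assumes "lit_pigeons l = {}"
  shows "mon_expect \<mu> (Poly_Mapping.single l 1 + m) = lit_val Map.empty l * mon_expect \<mu> m"
proof -
  have "mon_val \<sigma> (Poly_Mapping.single l 1 + m) * \<mu> \<sigma> =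
      lit_val Map.empty l * (mon_val \<sigma> m * \<mu> \<sigma>)" for \<sigma>
  proof -
    have "lit_val \<sigma> l = (lit_val Map.empty l :: 'a)"
      by (rule lit_val_cong) (simp add: assms)
    then show ?thesis by (simp only: mon_val_lit_add mult.assoc)
  qed
  then show ?thesis
    unfolding mon_expect_def pigeons_of_lit_add assms sum_distrib_left by (simp only: Un_empty_left)
qed

section \<open>Axioms and rules preserve expectation 0\<close>

lemma null_boolean: "null (lit_poly l ^ 2 - lit_poly l :: (erphp_var, 'a::field) pcr_poly)"
proof -
  have "(lit_poly l ^ 2 :: (erphp_var, 'a) pcr_poly) =
      Poly_Mapping.single (Poly_Mapping.single l 1 + Poly_Mapping.single l 1) 1"
    by (simp add: lit_poly_def power2_eq_square mult_single)
  moreover have "mon_expect \<mu> (Poly_Mapping.single l 1 + Poly_Mapping.single l 1) =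
      mon_expect \<mu> (Poly_Mapping.single l 1)" for \<mu> :: "(nat \<rightharpoonup> nat) \<Rightarrow> 'a"
    by (rule mon_expect_keys_cong) (simp add: keys_add_nat)
  ultimately show ?thesis
    unfolding null_def by (simp add: linear_ext_diff linear_ext_single lit_poly_def)
qed

text \<open>The values of a literal and its twin add up to 1. If they depend on a pigeon
  \<open>u\<close>, the total weight of its placements is the weight of the empty map, by
  compatibility on \<open>{u}\<close>, a small domain as \<open>1 \<le> e\<close>.\<close>

lemma null_complementary:
  "null (1 - lit_poly (Pos x) - lit_poly (Neg x) :: (erphp_var, 'a::field) pcr_poly)"
  unfolding null_def
proof (intro allI impI)
  fix \<mu> :: "(nat \<rightharpoonup> nat) \<Rightarrow> 'a" assume \<mu>: "compatible small holes \<mu>"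
  \<comment> \<open>The summand 0 brings single literals into the shape of the lemmas about adding a
    literal to a monomial.\<close>
  define m where "m = (\<lambda>l :: erphp_var literal. Poly_Mapping.single l (1::nat) + 0)"
  have "linear_ext (mon_expect \<mu>) 1 = mon_expect \<mu> 0"
    using linear_ext_single[of "mon_expect \<mu>" 0 1] by simp
  then have *: "linear_ext (mon_expect \<mu>) (1 - lit_poly (Pos x) - lit_poly (Neg x)) =
      mon_expect \<mu> 0 - mon_expect \<mu> (m (Pos x)) - mon_expect \<mu> (m (Neg x))"
    by (simp only: linear_ext_diff linear_ext_single lit_poly_def m_def mult_1_left add_0_right)
  have pn: "lit_pigeons (Neg x) = lit_pigeons (Pos x)" by (simp add: lit_pigeons_def)
  have vn: "lit_val \<sigma> (Pos x) + lit_val \<sigma> (Neg x) = (1 :: 'a)" for \<sigma> by (simp add: lit_val_def)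
  have "mon_expect \<mu> (m (Pos x)) + mon_expect \<mu> (m (Neg x)) = \<mu> Map.empty"
  proof (cases rule: lit_pigeons_cases[of "Pos x"])
    case fixed
    then show ?thesis using pn vn
      by (simp only: m_def mon_expect_fixed_add mon_expect_zero flip: distrib_right) simp
  next
    case (free u)
    have dm: "pigeons_of (m (Pos x)) = {u}" "pigeons_of (m (Neg x)) = {u}"
      using free pn unfolding m_def pigeons_of_lit_add by (auto simp: pigeons_of_def)
    have val: "mon_val \<sigma> (m l) = (lit_val \<sigma> l :: 'a)" for \<sigma> l
      unfolding m_def mon_val_lit_add by (simp add: mon_val_def)
    have "mon_expect \<mu> (m (Pos x)) + mon_expect \<mu> (m (Neg x)) =
        (\<Sum>\<sigma>\<in>partial_maps {u} holes. \<mu> \<sigma>)"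
      unfolding mon_expect_def dm val using vn
      by (simp flip: sum.distrib distrib_right)
    also have "\<dots> = (\<Sum>\<sigma>\<in>partial_maps {} holes. \<Sum>h\<in>holes. \<mu> (\<sigma>(u \<mapsto> h)))"
      by (rule sum_partial_maps_insert) auto
    also have "\<dots> = (\<Sum>h\<in>holes. \<mu> (Map.empty(u \<mapsto> h)))"
      unfolding partial_maps_empty by (subst sum.insert) (simp_all only: finite.emptyI empty_iff not_False_eq_True sum.empty add_0_right)
    also have "\<dots> = \<mu> Map.empty"
      by (rule compatible_marginal[OF \<mu>, symmetric]) (use free e in auto)
    finally show ?thesis .
  qed
  then show "linear_ext (mon_expect \<mu>) (1 - lit_poly (Pos x) - lit_poly (Neg x)) = 0"
    unfolding * by (simp add: mon_expect_zero algebra_simps)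
qed

lemma null_linear:
  assumes "null p" "null q"
  shows "null (const_poly \<alpha> * p + const_poly \<beta> * q)"
  using assms unfolding null_def
  by (simp add: linear_ext_add const_poly_def linear_ext_single_mult)

lemma var_true_used:
  assumes "u \<in> pigeons"
  shows "var_true \<sigma> (Q (s u) w) \<longleftrightarrow> \<sigma> u = Some w"
    and "var_true \<sigma> (Z (s u) w) \<longleftrightarrow> (\<exists>w'>w. \<sigma> u = Some w')"
proof -
  have "u' = u" if "u' \<in> pigeons" "s u' = s u" for u'
    by (rule inj_onD[OF s_inj that(2,1) assms])
  then show "var_true \<sigma> (Q (s u) w) \<longleftrightarrow> \<sigma> u = Some w"
    "var_true \<sigma> (Z (s u) w) \<longleftrightarrow> (\<exists>w'>w. \<sigma> u = Some w')"
    unfolding var_true.simps using assms imageI[of u pigeons s] by (metis, metis)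
qed

lemma clause_satisfied:
  assumes C: "C \<in> erphp k n" and \<sigma>: "inj_on \<sigma> (dom \<sigma>)" "ran \<sigma> \<subseteq> holes"
    and dom: "dom \<sigma> = (\<Union>l\<in>C. lit_pigeons l)"
  shows "\<exists>l\<in>C. lit_true \<sigma> l"
proof -
  have sr: "1 \<le> s u" "s u \<le> n" if "u \<in> pigeons" for u
  proof -
    have "s u \<in> {1..n}" by (rule subsetD[OF s_range imageI[OF that]])
    then show "1 \<le> s u" "s u \<le> n" by simp_all
  qed
  have hole: "\<exists>w. 1 \<le> w \<and> w \<le> k - 1 \<and> \<sigma> u = Some w"
    if "u \<in> pigeons" "l \<in> C" "s u \<in> middle (lit_var l)" for u l
  proof -
    have "u \<in> dom \<sigma>" using that unfolding dom lit_pigeons_def by blast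
    then obtain w where "\<sigma> u = Some w" by blast
    moreover from this have "w \<in> holes" using \<sigma>(2) ranI by fast
    ultimately show ?thesis by simp
  qed
  consider
    u where "u \<in> {1..k}" "C = {Pos (P u 1), Pos (P u 2), Pos (Y u 2)}"
  | u v where "u \<in> {1..k}" "v \<in> {2..n-3}" "C = {Neg (Y u v), Pos (P u (v+1)), Pos (Y u (v+1))}"
  | u where "u \<in> {1..k}" "C = {Neg (Y u (n-2)), Pos (P u (n-1)), Pos (P u n)}"
  | v where "v \<in> {1..n}" "C = {Neg (R v), Pos (Q v 1), Pos (Z v 1)}"
  | v w where "v \<in> {1..n}" "w \<in> {1..k-4}" "C = {Neg (Z v w), Pos (Q v (w+1)), Pos (Z v (w+1))}"
  | v where "v \<in> {1..n}" "C = {Neg (Z v (k-3)), Pos (Q v (k-2)), Pos (Q v (k-1))}"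
  | u u' v where "u \<in> {1..k}" "u' \<in> {1..k}" "u \<noteq> u'" "C = {Neg (P u v), Neg (P u' v)}"
  | u v where "u \<in> {1..k}" "C = {Neg (P u v), Pos (R v)}"
  | v v' where "v \<noteq> v'" "C = {Neg (R v), Neg (R v'), Pos (RR v v')}"
  | v v' w where "v \<noteq> v'" "C = {Neg (RR v v'), Neg (Q v w), Neg (Q v' w)}"
    using C unfolding erphp_def
    apply (elim UnE)
    subgoal by (elim CollectE exE conjE, rule that(1), assumption+)
    subgoal by (elim CollectE exE conjE, rule that(2), assumption+)
    subgoal by (elim CollectE exE conjE, rule that(3), assumption+)
    subgoal by (elim CollectE exE conjE, rule that(4), assumption+)
    subgoal by (elim CollectE exE conjE, rule that(5), assumption+)
    subgoal by (elim CollectE exE conjE, rule that(6), assumption+)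
    subgoal by (elim CollectE exE conjE, rule that(7), assumption+)
    subgoal by (elim CollectE exE conjE, rule that(8), assumption+)
    subgoal by (elim CollectE exE conjE, rule that(9), assumption+)
    subgoal by (elim CollectE exE conjE, rule that(10), assumption+)
    done
  then show ?thesis
  proof cases
    case (1 u)
    have "s u = 1 \<or> s u = 2 \<or> 2 < s u" using sr[OF 1(1)] by linarith
    then show ?thesis by (auto simp: 1(2))
  next
    case (2 u v)
    have "\<not> v < s u \<or> s u = v + 1 \<or> v + 1 < s u" by linarith
    then show ?thesis by (auto simp: 2(3))
  next
    case (3 u)
    have "\<not> n - 2 < s u \<or> s u = n - 1 \<or> s u = n" using sr[OF 3(1)] by linarith
    then show ?thesis by (auto simp: 3(2))
  next
    case (4 v)
    show ?thesis
    proof (cases "v \<in> s ` pigeons")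
      case True
      then obtain u where u: "u \<in> pigeons" "v = s u" by blast
      obtain w where w: "1 \<le> w" "\<sigma> u = Some w" using hole[OF u(1), of "Pos (Q v 1)"] 4 u by auto
      have "w = 1 \<or> 1 < w" using w(1) by linarith
      then have "var_true \<sigma> (Q v 1) \<or> var_true \<sigma> (Z v 1)"
        unfolding u(2) var_true_used[OF u(1)] w(2) by blast
      then show ?thesis unfolding 4 by (simp del: var_true.simps)
    qed (simp add: 4)
  next
    case (5 v w)
    show ?thesis
    proof (cases "v \<in> s ` pigeons")
      case True
      then obtain u where u: "u \<in> pigeons" "v = s u" by blast
      obtain x where x: "\<sigma> u = Some x" using hole[OF u(1), of "Neg (Z v w)"] 5 u by auto
      have "\<not> w < x \<or> x = w + 1 \<or> w + 1 < x" by linarith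
      then have "\<not> var_true \<sigma> (Z v w) \<or> var_true \<sigma> (Q v (w + 1)) \<or> var_true \<sigma> (Z v (w + 1))"
        unfolding u(2) var_true_used[OF u(1)] x by blast
      then show ?thesis unfolding 5 by (simp del: var_true.simps)
    qed (simp add: 5)
  next
    case (6 v)
    show ?thesis
    proof (cases "v \<in> s ` pigeons")
      case True
      then obtain u where u: "u \<in> pigeons" "v = s u" by blast
      obtain x where x: "x \<le> k - 1" "\<sigma> u = Some x" using hole[OF u(1), of "Neg (Z v (k-3))"] 6 u by auto
      have "\<not> k - 3 < x \<or> x = k - 2 \<or> x = k - 1" using x(1) by linarith
      then have "\<not> var_true \<sigma> (Z v (k-3)) \<or> var_true \<sigma> (Q v (k-2)) \<or> var_true \<sigma> (Q v (k-1))"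
        unfolding u(2) var_true_used[OF u(1)] x by blast
      then show ?thesis unfolding 6 by (simp del: var_true.simps)
    qed (simp add: 6)
  next
    case (7 u u' v)
    have "\<not> (s u = v \<and> s u' = v)" using inj_onD[OF s_inj _ 7(1,2)] 7(3) by auto
    then show ?thesis by (auto simp: 7(4))
  next
    case (8 u v)
    have "\<not> s u = v \<or> v \<in> s ` pigeons" using 8(1) by blast
    then show ?thesis by (auto simp: 8(2))
  next
    case (9 v v')
    then show ?thesis by simp
  next
    case (10 v v' w)
    have False if t: "var_true \<sigma> (RR v v')" "var_true \<sigma> (Q v w)" "var_true \<sigma> (Q v' w)"
    proof -
      obtain u u' where u: "u \<in> pigeons" "v = s u" "u' \<in> pigeons" "v' = s u'" using t(1) by auto
      have "\<sigma> u = Some w" "\<sigma> u' = Some w"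
        using t(2,3) unfolding u(2,4) var_true_used[OF u(1)] var_true_used[OF u(3)] by blast+
      then have "u = u'" using \<sigma>(1) by (metis domI inj_onD)
      then show False using 10(1) u by simp
    qed
    then show ?thesis unfolding 10(2) by (auto simp del: var_true.simps)
  qed
qed

text \<open>Each summand vanishes: a non-injective map has weight 0, an injective one satisfies the
  clause and gives value 0. Small domains are needed for the first case; killed monomials vanish
  anyway.\<close>

lemma null_clause:
  assumes C: "C \<in> erphp k n"
    and good: "\<And>m. m \<in> Poly_Mapping.keys (clause_poly C :: (erphp_var, 'a::field) pcr_poly) \<Longrightarrow>
      killed m \<or> card (pigeons_of m) \<le> e"
  shows "null (clause_poly C :: (erphp_var, 'a) pcr_poly)"
  unfolding null_def
proof (intro allI impI)
  fix \<mu> :: "(nat \<rightharpoonup> nat) \<Rightarrow> 'a" assume \<mu>: "compatible small holes \<mu>"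
  have "finite C" using C unfolding erphp_def by (elim UnE) auto
  then obtain m where m: "(clause_poly C :: (erphp_var, 'a) pcr_poly) = Poly_Mapping.single m 1"
    "Poly_Mapping.keys m = C" using clause_poly_single by blast
  have "mon_expect \<mu> m = 0"
  proof (cases "killed m")
    case False
    then have dm: "pigeons_of m \<in> small" using good[of m] m(1) pigeons_of_subset by auto
    show ?thesis unfolding mon_expect_def
    proof (rule sum.neutral, rule ballI)
      fix \<sigma> assume s: "\<sigma> \<in> partial_maps (pigeons_of m) holes"
      show "mon_val \<sigma> m * \<mu> \<sigma> = 0"
      proof (cases "inj_on \<sigma> (dom \<sigma>)")
        case True
        then have "\<exists>l\<in>C. lit_true \<sigma> l"
          using s m(2) by (intro clause_satisfied[OF C]) (auto simp: partial_maps_def pigeons_of_def)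
        then show ?thesis using mon_val_eq_0[of _ m] m(2) by auto
      next
        case False
        then show ?thesis using compatible_noninj[OF \<mu> _ _ False] s dm by (simp add: partial_maps_def)
      qed
    qed
  qed (rule mon_expect_killed)
  then show "linear_ext (mon_expect \<mu>) (clause_poly C) = 0" by (simp add: m(1) linear_ext_single)
qed

text \<open>If the restriction fixes \<open>l\<close>, it acts as a scalar. Otherwise the value of
  \<open>l\<close>, which depends on the hole of one pigeon \<open>u\<close>, is moved into the
  weights: the expectation of the product under \<open>\<mu>\<close> is that of \<open>q\<close>
  under new weights \<open>\<mu>'\<close>, again compatible.\<close>

lemma null_lit_mult:
  fixes q :: "(erphp_var, 'a::field) pcr_poly"
  assumes q: "null q"
    and good: "\<And>m. m \<in> Poly_Mapping.keys (lit_poly l * q) \<Longrightarrow> killed m \<or> card (pigeons_of m) \<le> e"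
  shows "null (lit_poly l * q)"
  unfolding null_def
proof (intro allI impI)
  fix \<mu> :: "(nat \<rightharpoonup> nat) \<Rightarrow> 'a" assume \<mu>: "compatible small holes \<mu>"
  have lin: "linear_ext (mon_expect \<mu>) (lit_poly l * q) =
      linear_ext (\<lambda>m. mon_expect \<mu> (Poly_Mapping.single l 1 + m)) q"
    unfolding lit_poly_def linear_ext_single_mult by simp
  show "linear_ext (mon_expect \<mu>) (lit_poly l * q) = 0"
  proof (cases rule: lit_pigeons_cases[of l])
    case fixed
    have "linear_ext (\<lambda>m. lit_val Map.empty l * mon_expect \<mu> m) q =
        lit_val Map.empty l * linear_ext (mon_expect \<mu>) q"
      unfolding linear_ext_def sum_distrib_left by (intro sum.cong refl) (simp only: mult_ac)
    then show ?thesis using q \<mu> unfolding lin mon_expect_fixed_add[OF fixed] null_def by simp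
  next
    case (free u)
    define c where "c = (\<lambda>\<sigma>. lit_val \<sigma> l :: 'a)"
    have c_upd: "c (\<sigma>(a \<mapsto> h)) = c \<sigma>" if "a \<noteq> u" for \<sigma> a h
      unfolding c_def using free that by (intro lit_val_cong) auto
    \<comment> \<open>The domains on which the new weights are prescribed: they stay small after
      adding \<open>u\<close>, so \<open>\<mu>\<close> can be summed over the hole of
      \<open>u\<close>.\<close>
    define D where "D = {A. A \<subseteq> pigeons \<and> card (insert u A) \<le> e}"
    have D_small: "insert u A \<in> small" if "A \<in> D" for A using that free by (auto simp: D_def)
    have D_fin: "finite A" if "A \<in> D" for A using that finite_subset[of A pigeons] by (auto simp: D_def)
    define \<mu>\<^sub>0 where "\<mu>\<^sub>0 = (\<lambda>\<sigma>. if u \<in> dom \<sigma> then c \<sigma> * \<mu> \<sigma>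
        else \<Sum>h\<in>holes. c (\<sigma>(u \<mapsto> h)) * \<mu> (\<sigma>(u \<mapsto> h)))"
    have "compatible D holes \<mu>\<^sub>0"
    proof (rule compatibleI)
      fix \<sigma> assume s: "dom \<sigma> \<in> D" "ran \<sigma> \<subseteq> holes" "\<not> inj_on \<sigma> (dom \<sigma>)"
      show "\<mu>\<^sub>0 \<sigma> = 0"
      proof (cases "u \<in> dom \<sigma>")
        case True
        then have "dom \<sigma> \<in> small" using D_small[OF s(1)] by (simp add: insert_absorb)
        then show ?thesis using True compatible_noninj[OF \<mu> _ s(2,3)] by (simp add: \<mu>\<^sub>0_def)
      next
        case False
        have "\<mu> (\<sigma>(u \<mapsto> h)) = 0" if "h \<in> holes" for h
        proof (rule compatible_noninj[OF \<mu>])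
          show "dom (\<sigma>(u \<mapsto> h)) \<in> small" using D_small[OF s(1)] by simp
          show "\<not> inj_on (\<sigma>(u \<mapsto> h)) (dom (\<sigma>(u \<mapsto> h)))" using inj_on_upd_iff[OF False] s(3) by blast
        qed (rule ran_upd_subset[OF s(2) that])
        then show ?thesis using False by (simp add: \<mu>\<^sub>0_def)
      qed
    next
      fix \<sigma> a assume a: "a \<notin> dom \<sigma>" "insert a (dom \<sigma>) \<in> D" "ran \<sigma> \<subseteq> holes"
      show "\<mu>\<^sub>0 \<sigma> = (\<Sum>h\<in>holes. \<mu>\<^sub>0 (\<sigma>(a \<mapsto> h)))"
      proof (cases "a = u")
        case True
        then show ?thesis using a(1) by (simp add: \<mu>\<^sub>0_def)
      next
        case au: False
        show ?thesis
        proof (cases "u \<in> dom \<sigma>")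
          case True
          then have "insert a (dom \<sigma>) \<in> small"
            using D_small[OF a(2)] by (simp add: insert_absorb insert_commute)
          then have "c \<sigma> * \<mu> \<sigma> = (\<Sum>h\<in>holes. c \<sigma> * \<mu> (\<sigma>(a \<mapsto> h)))"
            using compatible_marginal[OF \<mu> a(1) _ a(3)] by (simp only: sum_distrib_left)
          then show ?thesis using True by (simp add: \<mu>\<^sub>0_def c_upd[OF au])
        next
          case False
          have "\<mu> (\<sigma>(u \<mapsto> h)) = (\<Sum>h'\<in>holes. \<mu> (\<sigma>(a \<mapsto> h', u \<mapsto> h)))" if h: "h \<in> holes" for h
          proof -
            have "\<mu> (\<sigma>(u \<mapsto> h)) = (\<Sum>h'\<in>holes. \<mu> (\<sigma>(u \<mapsto> h, a \<mapsto> h')))"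
            proof (rule compatible_marginal[OF \<mu>])
              show "insert a (dom (\<sigma>(u \<mapsto> h))) \<in> small"
                using D_small[OF a(2)] by (simp add: insert_commute)
            qed (use a au ran_upd_subset[OF a(3) h] in auto)
            then show ?thesis by (simp only: fun_upd_twist[OF au])
          qed
          moreover have "c (\<sigma>(u \<mapsto> h)) = c (\<sigma>(a \<mapsto> h', u \<mapsto> h))" for h h'
            using c_upd[OF au, of "\<sigma>(u \<mapsto> h)" h'] fun_upd_twist[OF au, of \<sigma> "Some h'" "Some h"] by simp
          ultimately have "(\<Sum>h\<in>holes. c (\<sigma>(u \<mapsto> h)) * \<mu> (\<sigma>(u \<mapsto> h))) =
              (\<Sum>h\<in>holes. \<Sum>h'\<in>holes. c (\<sigma>(a \<mapsto> h', u \<mapsto> h)) * \<mu> (\<sigma>(a \<mapsto> h', u \<mapsto> h)))"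
            by (intro sum.cong refl) (simp only: sum_distrib_left)
          also have "\<dots> = (\<Sum>h'\<in>holes. \<Sum>h\<in>holes. c (\<sigma>(a \<mapsto> h', u \<mapsto> h)) * \<mu> (\<sigma>(a \<mapsto> h', u \<mapsto> h)))"
            by (rule sum.swap)
          finally show ?thesis using False au by (simp add: \<mu>\<^sub>0_def)
        qed
      qed
    qed
    \<comment> \<open>The small domains missing from \<open>D\<close> have exactly \<open>e\<close>
      pigeons and avoid \<open>u\<close>. Their proper subsets lie in \<open>D\<close>, so the
      weights extend to them.\<close>
    then have "\<exists>\<mu>'. compatible small holes \<mu>' \<and> (\<forall>\<sigma>. dom \<sigma> \<in> D \<longrightarrow> \<mu>' \<sigma> = \<mu>\<^sub>0 \<sigma>)"
    proof (rule compatible_extend_family)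
      fix A B assume A: "A \<in> D" "B \<subset> A"
      have "card (insert u B) \<le> card (insert u A)" using A D_fin by (intro card_mono) auto
      then show "B \<in> D" using A by (auto simp: D_def)
    next
      fix A assume A: "A \<in> small - D"
      then have fA: "finite A" and Ap: "A \<subseteq> pigeons" and cA: "card A \<le> e"
        using finite_subset[of A pigeons] by auto
      have "card (insert u B) \<le> e" if "B \<subset> A" for B
      proof -
        have "finite B" using that fA finite_subset by blast
        then have "card (insert u B) \<le> Suc (card B)" by (simp add: card_insert_if)
        then show ?thesis using psubset_card_mono[OF fA that] cA by linarith
      qed
      then have "{B. B \<subset> A} \<subseteq> D" using Ap by (auto simp: D_def)
      then show "finite A \<and> 2 * card A \<le> card holes \<and> {B. B \<subset> A} \<subseteq> D"
        using fA cA e(2) by simp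
    qed simp
    then obtain \<mu>' where \<mu>': "compatible small holes \<mu>'" "\<And>\<sigma>. dom \<sigma> \<in> D \<Longrightarrow> \<mu>' \<sigma> = \<mu>\<^sub>0 \<sigma>" by blast
    have "mon_expect \<mu> (Poly_Mapping.single l 1 + m) = mon_expect \<mu>' m"
      if m: "m \<in> Poly_Mapping.keys q" for m
    proof (cases "killed m")
      case True
      then have "killed (Poly_Mapping.single l 1 + m)" by (auto simp: killed_def keys_add_nat)
      then show ?thesis using True by (simp only: mon_expect_killed)
    next
      case False
      \<comment> \<open>\<open>l\<close> is not fixed and so cannot kill. Since no term cancels in
        the product, \<open>good\<close> bounds the pigeons of this term, \<open>u\<close>
        included.\<close>
      have "\<not> killed (Poly_Mapping.single l 1 + m)"
        using False free by (auto simp: killed_def keys_add_nat)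
      then have "card (insert u (pigeons_of m)) \<le> e"
        using good[OF keys_lit_mult[OF m, of l]] free unfolding pigeons_of_lit_add by simp
      then have D: "pigeons_of m \<in> D" using pigeons_of_subset by (simp add: D_def)
      show ?thesis
      \<comment> \<open>If \<open>m\<close> involves \<open>u\<close>, the new weight is the old one
        times the value of \<open>l\<close>. If not, the product has one more pigeon to sum over,
        and the new weight has performed that sum.\<close>
      proof (cases "u \<in> pigeons_of m")
        case True
        then have "lit_pigeons l \<union> pigeons_of m = pigeons_of m" using free by auto
        then show ?thesis unfolding mon_expect_def pigeons_of_lit_add mon_val_lit_add
          using True D by (intro sum.cong) (auto simp: partial_maps_def \<mu>'(2) \<mu>\<^sub>0_def c_def)
      next
        case False
        have mv: "mon_val (\<sigma>(u \<mapsto> h)) m = (mon_val \<sigma> m :: 'a)" for \<sigma> h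
          using False by (intro mon_val_cong) auto
        have "mon_expect \<mu> (Poly_Mapping.single l 1 + m) =
            (\<Sum>\<sigma>\<in>partial_maps (insert u (pigeons_of m)) holes. c \<sigma> * mon_val \<sigma> m * \<mu> \<sigma>)"
          unfolding mon_expect_def pigeons_of_lit_add mon_val_lit_add free(1) c_def by simp
        also have "\<dots> = (\<Sum>\<sigma>\<in>partial_maps (pigeons_of m) holes. \<Sum>h\<in>holes.
            c (\<sigma>(u \<mapsto> h)) * mon_val (\<sigma>(u \<mapsto> h)) m * \<mu> (\<sigma>(u \<mapsto> h)))"
          by (rule sum_partial_maps_insert[OF False])
        also have "\<dots> = mon_expect \<mu>' m"
          unfolding mon_expect_def mv
        proof (rule sum.cong[OF refl])
          fix \<sigma> assume "\<sigma> \<in> partial_maps (pigeons_of m) holes"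
          then have "dom \<sigma> = pigeons_of m" by (simp add: partial_maps_def)
          then have "\<mu>' \<sigma> = (\<Sum>h\<in>holes. c (\<sigma>(u \<mapsto> h)) * \<mu> (\<sigma>(u \<mapsto> h)))"
            using \<mu>'(2)[of \<sigma>] D False by (simp add: \<mu>\<^sub>0_def)
          then show "(\<Sum>h\<in>holes. c (\<sigma>(u \<mapsto> h)) * mon_val \<sigma> m * \<mu> (\<sigma>(u \<mapsto> h))) = mon_val \<sigma> m * \<mu>' \<sigma>"
            by (simp only: sum_distrib_left mult_ac)
        qed
        finally show ?thesis .
      qed
    qed
    then have "linear_ext (mon_expect \<mu>) (lit_poly l * q) = linear_ext (mon_expect \<mu>') q"
      unfolding lin by (rule linear_ext_cong)
    then show ?thesis using q \<mu>'(1) unfolding null_def by simp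
  qed
qed

lemma refutation_has_wide_term:
  fixes \<pi> :: "(erphp_var, 'a::field) pcr_poly list"
  assumes \<pi>: "pcr_refutation (erphp_vars k n) (erphp k n) \<pi>"
  shows "\<exists>p\<in>set \<pi>. \<exists>m\<in>Poly_Mapping.keys p. \<not> killed m \<and> e < card (pigeons_of m)"
proof (rule ccontr)
  assume "\<not> ?thesis"
  then have good: "\<And>p m. p \<in> set \<pi> \<Longrightarrow> m \<in> Poly_Mapping.keys p \<Longrightarrow> killed m \<or> card (pigeons_of m) \<le> e"
    by force
  have ref: "\<pi> \<noteq> []" "last \<pi> = 1"
    "\<And>i. i < length \<pi> \<Longrightarrow> pcr_inference (erphp_vars k n) (erphp k n) (set (take i \<pi>)) (\<pi> ! i)"
    using \<pi> unfolding pcr_refutation_def by auto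
  have null: "null (\<pi> ! i)" if "i < length \<pi>" for i
    using that
  proof (induction i rule: less_induct)
    case (less i)
    have prev: "null q" if "q \<in> set (take i \<pi>)" for q
      using that less by (auto simp: in_set_conv_nth)
    note gi = good[OF nth_mem[OF less.prems]]
    from ref(3)[OF less.prems] consider
      l where "\<pi> ! i = lit_poly l ^ 2 - lit_poly l"
    | x where "\<pi> ! i = 1 - lit_poly (Pos x) - lit_poly (Neg x)"
    | C where "C \<in> erphp k n" "\<pi> ! i = clause_poly C"
    | q q' \<alpha> \<beta> where "q \<in> set (take i \<pi>)" "q' \<in> set (take i \<pi>)"
        "\<pi> ! i = const_poly \<alpha> * q + const_poly \<beta> * q'"
    | q l where "q \<in> set (take i \<pi>)" "\<pi> ! i = lit_poly l * q"
      unfolding pcr_inference_def by blast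
    then show ?case
    proof cases
      case 1 then show ?thesis by (simp only: null_boolean)
    next
      case 2 then show ?thesis by (simp only: null_complementary)
    next
      case 3 then show ?thesis using gi null_clause by metis
    next
      case 4 then show ?thesis using prev null_linear by metis
    next
      case 5 then show ?thesis using gi prev null_lit_mult by metis
    qed
  qed
  have "null (1 :: (erphp_var, 'a) pcr_poly)"
    using null[of "length \<pi> - 1"] ref(1,2) by (simp add: last_conv_nth)
  moreover obtain \<mu> :: "(nat \<rightharpoonup> nat) \<Rightarrow> 'a" where \<mu>: "compatible small holes \<mu>" "\<mu> Map.empty = 1"
    using compatible_exists[of pigeons holes e] e(2) by auto
  ultimately have "linear_ext (mon_expect \<mu>) (1 :: (erphp_var, 'a) pcr_poly) = 0"
    unfolding null_def by blast
  then show False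
    using linear_ext_single[of "mon_expect \<mu>" 0 1] \<mu>(2) by (simp add: mon_expect_zero)
qed

end

section \<open>Random restrictions\<close>

definition mentioned :: "(erphp_var literal \<Rightarrow>\<^sub>0 nat) \<Rightarrow> nat set" where
  "mentioned m = (\<Union>l\<in>Poly_Mapping.keys m. middle (lit_var l))"

text \<open>No \<open>Q\<close> or \<open>Z\<close> literal at a place outside \<open>S\<close> is
  made true by the bits \<open>B\<close>. This is implied by not being killed and depends on
  \<open>s\<close> only through the set \<open>S\<close> of reserved places.\<close>

definition survives :: "nat set \<Rightarrow> nat set \<Rightarrow> (erphp_var literal \<Rightarrow>\<^sub>0 nat) \<Rightarrow> bool" where
  "survives S B m \<longleftrightarrow> (\<forall>l\<in>Poly_Mapping.keys m. \<forall>v\<in>middle (lit_var l) - S. v \<in> B \<longleftrightarrow> l = Neg (lit_var l))"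

lemma (in restriction) survives_if_not_killed: "\<not> killed m \<Longrightarrow> survives (s ` pigeons) B m"
  unfolding survives_def
proof (intro ballI)
  fix l v assume m: "\<not> killed m" "l \<in> Poly_Mapping.keys m" "v \<in> middle (lit_var l) - s ` pigeons"
  have "middle (lit_var l) = {v}" using m(3) by (cases "lit_var l") auto
  then have "lit_pigeons l = {}" using m(3) unfolding lit_pigeons_def by auto
  then have "\<not> lit_true Map.empty l" using m(1,2) by (auto simp: killed_def)
  moreover have "var_true Map.empty (lit_var l) \<longleftrightarrow> v \<in> B" using m(3) by (cases "lit_var l") auto
  ultimately show "v \<in> B \<longleftrightarrow> l = Neg (lit_var l)" by (cases l) auto
qed

lemma (in restriction) pigeons_of_eq: "pigeons_of m = {u \<in> pigeons. s u \<in> mentioned m}"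
  by (auto simp: pigeons_of_def lit_pigeons_def mentioned_def)

text \<open>Consecutive intervals of length \<open>b\<close>, numbered from 1 like the
  pigeons.\<close>

definition block :: "nat \<Rightarrow> nat \<Rightarrow> nat set" where
  "block b u = {(u - 1) * b <.. u * b}"

lemma finite_block [simp]: "finite (block b u)"
  and card_block: "1 \<le> u \<Longrightarrow> card (block b u) = b"
  by (auto simp: block_def algebra_simps diff_mult_distrib)

lemma block_disjoint:
  assumes "x \<in> block b u" "x \<in> block b u'" "1 \<le> u" "1 \<le> u'"
  shows "u = u'"
proof -
  have "\<not> u < u'" if "x \<in> block b u" "x \<in> block b u'" for u u'
  proof
    assume "u < u'"
    then have "u * b \<le> (u' - 1) * b" by (intro mult_le_mono1) linarith
    moreover have "x \<le> u * b" "(u' - 1) * b < x" using that by (simp_all add: block_def)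
    ultimately show False by linarith
  qed
  from this[OF assms(1,2)] this[OF assms(2,1)] show ?thesis by linarith
qed

definition transversals :: "nat \<Rightarrow> nat \<Rightarrow> (nat \<Rightarrow> nat) set" where
  "transversals k b = PiE {1..k} (block b)"

lemma card_transversals: "card (transversals k b) = b ^ k"
  unfolding transversals_def by (subst card_PiE) (simp_all add: card_block)

lemma transversal_inj: "s \<in> transversals k b \<Longrightarrow> inj_on s {1..k}"
proof (rule inj_onI)
  fix u u' assume s: "s \<in> transversals k b" and u: "u \<in> {1..k}" "u' \<in> {1..k}" "s u = s u'"
  have "s u \<in> block b u" "s u' \<in> block b u'" using s u unfolding transversals_def by (auto dest: PiE_mem)
  then show "u = u'" using block_disjoint[of "s u" b u u'] u by simp
qed

lemma transversal_range:
  assumes "s \<in> transversals k b" "k * b \<le> n"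
  shows "s ` {1..k} \<subseteq> {1..n}"
proof (rule image_subsetI)
  fix u assume u: "u \<in> {1..k}"
  have "s u \<in> block b u" using assms(1) u unfolding transversals_def by (rule PiE_mem)
  then have "(u - 1) * b < s u" "s u \<le> u * b" by (simp_all add: block_def)
  moreover have "u * b \<le> k * b" using u by simp
  ultimately have "1 \<le> s u" "s u \<le> n" using assms(2) by linarith+
  then show "s u \<in> {1..n}" by simp
qed

text \<open>Each place lies in at most one block, so hitting it fixes the choice of one pigeon. Thus
  \<open>d\<close> choices are forced and \<open>k - d\<close> remain free; any one such transversal
  identifies the forced pigeons.\<close>

lemma card_transversals_through:
  assumes "card D = d"
  shows "card {s \<in> transversals k b. D \<subseteq> s ` {1..k}} \<le> b ^ (k - d)"
proof (cases "{s \<in> transversals k b. D \<subseteq> s ` {1..k}} = {}")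
  case False
  then obtain s\<^sub>0 where s\<^sub>0: "s\<^sub>0 \<in> transversals k b" "D \<subseteq> s\<^sub>0 ` {1..k}" by blast
  have blk: "s u \<in> block b u" if "s \<in> transversals k b" "u \<in> {1..k}" for s u
    using that unfolding transversals_def by (rule PiE_mem)
  define U where "U = {u \<in> {1..k}. s\<^sub>0 u \<in> D}"
  have "s\<^sub>0 ` U = D" using s\<^sub>0(2) by (auto simp: U_def)
  moreover have "inj_on s\<^sub>0 U" by (rule inj_on_subset[OF transversal_inj[OF s\<^sub>0(1)]]) (auto simp: U_def)
  ultimately have cU: "card U = d" using assms card_image by metis
  have fixed: "s u = s\<^sub>0 u" if s: "s \<in> transversals k b" "D \<subseteq> s ` {1..k}" and u: "u \<in> U" for s u
  proof -
    have u1: "u \<in> {1..k}" "s\<^sub>0 u \<in> D" using u by (auto simp: U_def)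
    then obtain u' where u': "u' \<in> {1..k}" "s\<^sub>0 u = s u'" using s(2) by blast
    have "u' = u"
    proof (rule block_disjoint)
      show "s u' \<in> block b u'" by (rule blk[OF s(1) u'(1)])
      show "s u' \<in> block b u" using blk[OF s\<^sub>0(1) u1(1)] u'(2) by simp
    qed (use u1 u' in auto)
    then show ?thesis using u'(2) by simp
  qed
  let ?T = "PiE {1..k} (\<lambda>u. if u \<in> U then {s\<^sub>0 u} else block b u)"
  have "{s \<in> transversals k b. D \<subseteq> s ` {1..k}} \<subseteq> ?T"
  proof
    fix s assume "s \<in> {s \<in> transversals k b. D \<subseteq> s ` {1..k}}"
    then have s: "s \<in> transversals k b" "D \<subseteq> s ` {1..k}" by auto
    show "s \<in> ?T"
    proof (rule PiE_I)
      fix u assume "u \<in> {1..k}"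
      then show "s u \<in> (if u \<in> U then {s\<^sub>0 u} else block b u)"
        using fixed[OF s] blk[OF s(1)] by simp
    next
      fix u assume "u \<notin> {1..k}"
      then show "s u = undefined" using s(1) unfolding transversals_def by (rule PiE_arb[rotated])
    qed
  qed
  then have "card {s \<in> transversals k b. D \<subseteq> s ` {1..k}} \<le> card ?T"
    by (intro card_mono finite_PiE) auto
  also have "card ?T = (\<Prod>u\<in>{1..k}. if u \<in> U then 1 else b)"
    by (subst card_PiE) (auto simp: card_block intro!: prod.cong)
  also have "\<dots> = b ^ card ({1..k} - U)"
  proof -
    have "{1..k} \<inter> - U = {1..k} - U" by auto
    then show ?thesis by (simp add: prod.If_cases)
  qed
  also have "card ({1..k} - U) = k - d" using cU by (subst card_Diff_subset) (auto simp: U_def)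
  finally show ?thesis .
qed (simp only: card.empty)

text \<open>Union bound over the \<open>d\<close>-element subsets of \<open>M\<close>, whose number
  is at most \<open>card M ^ d\<close>.\<close>

lemma card_transversals_hitting:
  assumes "finite M"
  shows "card {s \<in> transversals k b. d \<le> card {u \<in> {1..k}. s u \<in> M}} \<le> card M ^ d * b ^ (k - d)"
proof -
  let ?Ds = "{D. D \<subseteq> M \<and> card D = d}"
  have finT: "finite (transversals k b)" unfolding transversals_def by (intro finite_PiE) auto
  have fin: "finite ?Ds" using assms by simp
  have "{s \<in> transversals k b. d \<le> card {u \<in> {1..k}. s u \<in> M}} \<subseteq>
      (\<Union>D\<in>?Ds. {s \<in> transversals k b. D \<subseteq> s ` {1..k}})"
  proof
    fix s assume "s \<in> {s \<in> transversals k b. d \<le> card {u \<in> {1..k}. s u \<in> M}}"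
    then have s: "s \<in> transversals k b" "d \<le> card {u \<in> {1..k}. s u \<in> M}" by auto
    obtain U where U: "U \<subseteq> {u \<in> {1..k}. s u \<in> M}" "card U = d"
      using obtain_subset_with_card_n[OF s(2)] by blast
    have "inj_on s U" by (rule inj_on_subset[OF transversal_inj[OF s(1)]]) (use U in auto)
    then have "s ` U \<in> ?Ds" using U card_image[of s U] by auto
    moreover have "s ` U \<subseteq> s ` {1..k}" using U by auto
    ultimately show "s \<in> (\<Union>D\<in>?Ds. {s \<in> transversals k b. D \<subseteq> s ` {1..k}})" using s(1) by blast
  qed
  then have "card {s \<in> transversals k b. d \<le> card {u \<in> {1..k}. s u \<in> M}} \<le>
      card (\<Union>D\<in>?Ds. {s \<in> transversals k b. D \<subseteq> s ` {1..k}})"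
    using fin finT by (intro card_mono) auto
  also have "\<dots> \<le> (\<Sum>D\<in>?Ds. card {s \<in> transversals k b. D \<subseteq> s ` {1..k}})"
    by (rule card_UN_le[OF fin])
  also have "\<dots> \<le> (\<Sum>D\<in>?Ds. b ^ (k - d))"
    by (intro sum_mono card_transversals_through) auto
  also have "\<dots> = (card M choose d) * b ^ (k - d)" using n_subsets[OF assms] by simp
  also have "\<dots> \<le> card M ^ d * b ^ (k - d)"
  proof (cases "d \<le> card M")
    case True
    then show ?thesis by (intro mult_le_mono1 binomial_le_pow)
  qed (simp add: binomial_eq_0)
  finally show ?thesis .
qed

text \<open>Survival forces the bit of every mentioned place outside \<open>S\<close>, so the
  remaining bits determine \<open>B\<close>. At most \<open>k\<close> mentioned places lie in
  \<open>S\<close>, which gives the factor \<open>2 ^ k\<close>.\<close>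

lemma card_surviving:
  assumes "card S \<le> k" "finite S"
  shows "2 ^ card (mentioned m \<inter> {1..n}) * card {B \<in> Pow {1..n}. survives S B m} \<le> 2 ^ (n + k)"
proof -
  let ?M = "mentioned m \<inter> {1..n}" and ?X = "{B \<in> Pow {1..n}. survives S B m}"
  have inj: "inj_on (\<lambda>B. B - (?M - S)) ?X"
  proof (rule inj_onI)
    fix B B' assume B: "B \<in> ?X" "B' \<in> ?X" "B - (?M - S) = B' - (?M - S)"
    have "v \<in> B \<longleftrightarrow> v \<in> B'" if "v \<in> ?M - S" for v
      using that B(1,2) unfolding mentioned_def survives_def by blast
    then show "B = B'" using B(3) by blast
  qed
  have "card ?X = card ((\<lambda>B. B - (?M - S)) ` ?X)" using card_image[OF inj] by simp
  also have "\<dots> \<le> card (Pow ({1..n} - (?M - S)))" by (rule card_mono) auto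
  also have "\<dots> = 2 ^ (n - card (?M - S))"
  proof -
    have "card ({1..n} - (?M - S)) = n - card (?M - S)" by (subst card_Diff_subset) auto
    then show ?thesis by (simp add: card_Pow)
  qed
  finally have "card ?X \<le> 2 ^ (n - card (?M - S))" .
  then have "2 ^ card ?M * card ?X \<le> 2 ^ card ?M * 2 ^ (n - card (?M - S))" by (rule mult_le_mono2)
  also have "\<dots> = 2 ^ (card ?M + (n - card (?M - S)))" by (simp add: power_add)
  also have "\<dots> \<le> 2 ^ (n + k)"
  proof (rule power_increasing)
    have "card (?M - S) \<le> card {1..n}" by (rule card_mono) auto
    moreover have "card ?M - card S \<le> card (?M - S)" by (rule diff_card_le_card_Diff[OF assms(2)])
    ultimately show "card ?M + (n - card (?M - S)) \<le> n + k" using assms(1) by simp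
  qed simp
  finally show ?thesis .
qed

lemma card_terms_le_pcr_size: "card (\<Union>p\<in>set \<pi>. Poly_Mapping.keys p) \<le> pcr_size \<pi>"
proof (induction \<pi>)
  case (Cons p \<pi>)
  have "card (\<Union>q\<in>set (p # \<pi>). Poly_Mapping.keys q) \<le>
      card (Poly_Mapping.keys p) + card (\<Union>q\<in>set \<pi>. Poly_Mapping.keys q)"
    by (simp add: card_Un_le)
  then show ?case using Cons by (simp add: pcr_size_def num_terms_def)
qed simp

section \<open>Union bound over the terms of a refutation\<close>

text \<open>Every restriction leaves a term with at least \<open>d\<close> pigeons alive, while each
  term does so for at most a fraction \<open>\<epsilon>\<close> of all restrictions. The first
  condition on \<open>\<epsilon>\<close> serves terms mentioning more than \<open>W\<close> places,
  the second one the others.\<close>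

lemma refutation_size_ge:
  fixes \<pi> :: "(erphp_var, 'a::field) pcr_poly list" and W \<epsilon> :: real
  assumes k: "4 \<le> k" "4 \<le> n" and \<pi>: "pcr_refutation (erphp_vars k n) (erphp k n) \<pi>"
    and b: "1 \<le> b" "k * b \<le> n" and d: "d = k div 2"
    and \<epsilon>: "2 ^ k \<le> \<epsilon> * 2 powr W" "W ^ d \<le> \<epsilon> * real b ^ d" and W: "0 \<le> W"
  shows "1 \<le> real (pcr_size \<pi>) * \<epsilon>"
proof -
  let ?T = "\<Union>p\<in>set \<pi>. Poly_Mapping.keys p" and ?S = "transversals k b" and ?P = "Pow {1..n}"
  define bad where "bad m = {(s, B) \<in> ?S \<times> ?P.
      survives (s ` {1..k}) B m \<and> d \<le> card {u \<in> {1..k}. s u \<in> mentioned m \<inter> {1..n}}}" for m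
  have finS: "finite ?S" unfolding transversals_def by (intro finite_PiE) auto
  have finT: "finite ?T" by auto
  have fin_bad: "finite (bad m)" for m
    by (rule finite_subset[of _ "?S \<times> ?P"]) (use finS in \<open>auto simp: bad_def\<close>)
  have \<epsilon>0: "0 \<le> \<epsilon>" using \<epsilon>(1) by (smt (verit) powr_gt_zero zero_le_power zero_le_mult_iff zero_less_power)
  have "?S \<times> ?P \<subseteq> (\<Union>m\<in>?T. bad m)"
  proof (rule subrelI)
    fix s B assume sB: "(s, B) \<in> ?S \<times> ?P"
    \<comment> \<open>With \<open>d = k div 2\<close> the bound
      \<open>2 * (d - 1) \<le> k - 1\<close> holds, and exceeding \<open>d - 1\<close> pigeons means
      having at least \<open>d\<close>.\<close>
    interpret restriction k n "d - 1" s B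
      using k d sB transversal_inj[of s k b] transversal_range[of s k b n] b by unfold_locales auto
    obtain p m where m: "p \<in> set \<pi>" "m \<in> Poly_Mapping.keys p" "\<not> killed m" "d - 1 < card (pigeons_of m)"
      using refutation_has_wide_term[OF \<pi>] by blast
    have "pigeons_of m = {u \<in> {1..k}. s u \<in> mentioned m \<inter> {1..n}}"
      unfolding pigeons_of_eq using s_range by blast
    then have "(s, B) \<in> bad m"
      using sB m(4) survives_if_not_killed[OF m(3)] by (simp add: bad_def)
    then show "(s, B) \<in> (\<Union>m\<in>?T. bad m)" using m by blast
  qed
  then have "card (?S \<times> ?P) \<le> card (\<Union>m\<in>?T. bad m)"
    using finT fin_bad by (intro card_mono) auto
  also have "\<dots> \<le> (\<Sum>m\<in>?T. card (bad m))" by (rule card_UN_le[OF finT])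
  finally have "b ^ k * 2 ^ n \<le> (\<Sum>m\<in>?T. card (bad m))"
    by (simp add: card_cartesian_product card_transversals card_Pow)
  then have "real (b ^ k * 2 ^ n) \<le> real (\<Sum>m\<in>?T. card (bad m))" by (simp only: of_nat_le_iff)
  then have "real b ^ k * 2 ^ n \<le> (\<Sum>m\<in>?T. real (card (bad m)))" by simp
  also have "\<dots> \<le> (\<Sum>m\<in>?T. \<epsilon> * (real b ^ k * 2 ^ n))"
  proof (rule sum_mono)
    fix m assume "m \<in> ?T"
    let ?M = "mentioned m \<inter> {1..n}"
    show "real (card (bad m)) \<le> \<epsilon> * (real b ^ k * 2 ^ n)"
    proof (cases "real (card ?M) \<le> W")
      case True
      have "bad m \<subseteq> {s \<in> ?S. d \<le> card {u \<in> {1..k}. s u \<in> ?M}} \<times> ?P" by (auto simp: bad_def)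
      then have "card (bad m) \<le> card ({s \<in> ?S. d \<le> card {u \<in> {1..k}. s u \<in> ?M}} \<times> ?P)"
        using finS by (intro card_mono) auto
      also have "\<dots> \<le> card ?M ^ d * b ^ (k - d) * 2 ^ n"
        using card_transversals_hitting[of ?M k b d] by (simp add: card_cartesian_product card_Pow)
      finally have "real (card (bad m)) \<le> real (card ?M ^ d * b ^ (k - d) * 2 ^ n)"
        by (simp only: of_nat_le_iff)
      also have "\<dots> = real (card ?M) ^ d * (real b ^ (k - d) * 2 ^ n)" by simp
      also have "\<dots> \<le> (\<epsilon> * real b ^ d) * (real b ^ (k - d) * 2 ^ n)"
        using True \<epsilon>(2) by (intro mult_right_mono order_trans[OF power_mono \<epsilon>(2)]) auto
      also have "\<dots> = \<epsilon> * (real b ^ (d + (k - d)) * 2 ^ n)" by (simp add: power_add)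
      finally show ?thesis using d by simp
    next
      case False
      have "bad m \<subseteq> Sigma ?S (\<lambda>s. {B \<in> ?P. survives (s ` {1..k}) B m})" by (auto simp: bad_def)
      then have "card (bad m) \<le> card (Sigma ?S (\<lambda>s. {B \<in> ?P. survives (s ` {1..k}) B m}))"
        using finS by (intro card_mono) auto
      also have "\<dots> = (\<Sum>s\<in>?S. card {B \<in> ?P. survives (s ` {1..k}) B m})"
        using finS by (subst card_SigmaI) auto
      finally have "real (card (bad m)) \<le> (\<Sum>s\<in>?S. real (card {B \<in> ?P. survives (s ` {1..k}) B m}))"
        by (simp flip: of_nat_sum)
      also have "\<dots> \<le> (\<Sum>s\<in>?S. \<epsilon> * 2 ^ n)"
      proof (rule sum_mono)
        fix s assume "s \<in> ?S"
        let ?c = "card {B \<in> ?P. survives (s ` {1..k}) B m}"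
        have "card (s ` {1..k}) \<le> k" using card_image_le[of "{1..k}" s] by simp
        then have "2 ^ card ?M * ?c \<le> 2 ^ (n + k)" by (rule card_surviving) simp
        then have "real (2 ^ card ?M * ?c) \<le> real (2 ^ (n + k))" by (simp only: of_nat_le_iff)
        then have "2 powr card ?M * real ?c \<le> 2 ^ n * 2 ^ k" by (simp add: powr_realpow power_add)
        also have "\<dots> \<le> 2 ^ n * (\<epsilon> * 2 powr W)" using \<epsilon>(1) by simp
        also have "\<dots> \<le> 2 ^ n * (\<epsilon> * 2 powr card ?M)" using False \<epsilon>0 by (intro mult_left_mono) auto
        finally have "2 powr card ?M * real ?c \<le> 2 powr card ?M * (\<epsilon> * 2 ^ n)" by (simp only: mult_ac)
        then show "real ?c \<le> \<epsilon> * 2 ^ n" by simp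
      qed
      also have "\<dots> = \<epsilon> * (real b ^ k * 2 ^ n)" by (simp add: card_transversals)
      finally show ?thesis .
    qed
  qed
  also have "\<dots> = real (card ?T) * \<epsilon> * (real b ^ k * 2 ^ n)" by simp
  also have "\<dots> \<le> real (pcr_size \<pi>) * \<epsilon> * (real b ^ k * 2 ^ n)"
    using card_terms_le_pcr_size[of \<pi>] \<epsilon>0 by (intro mult_right_mono) auto
  finally have "1 * (real b ^ k * 2 ^ n) \<le> real (pcr_size \<pi>) * \<epsilon> * (real b ^ k * 2 ^ n)" by simp
  moreover have "0 < real b ^ k * 2 ^ n" using b by simp
  ultimately show ?thesis by (rule mult_right_le_imp_le)
qed

text \<open>The union bound is applied with \<open>W = A = 4 k log n\<close>, blocks of length
  \<open>n div k\<close>, and \<open>\<epsilon>\<close> the inverse of the claimed bound.\<close>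

lemma refutation_size_lower_bound:
  fixes \<pi> :: "(erphp_var, 'a::field) pcr_poly list"
  assumes k: "4 \<le> k" "4 \<le> n" "real k \<le> real n / (4 * log 2 (real n))"
    and \<pi>: "pcr_refutation (erphp_vars k n) (erphp k n) \<pi>"
  shows "real n ^ nat \<lceil>(real k - 1) / 2\<rceil> / (4 * real k * log 2 (real n)) ^ k \<le> real (pcr_size \<pi>)"
proof -
  define L where "L = log 2 (real n)"
  define A where "A = 4 * real k * L"
  define d where "d = k div 2"
  define b where "b = n div k"
  have d_eq: "nat \<lceil>(real k - 1) / 2\<rceil> = d"
  proof -
    have "\<lceil>(real k - 1) / 2\<rceil> = int d"
    proof (cases "even k")
      case True
      then have "real k = 2 * real d" by (auto simp: d_def elim: evenE)
      then show ?thesis by (simp add: ceiling_eq_iff)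
    next
      case False
      then have "real k = 2 * real d + 1" by (auto simp: d_def elim: oddE)
      then show ?thesis by simp
    qed
    then show ?thesis by simp
  qed
  have "log 2 4 \<le> L" unfolding L_def using k(2) by (intro log_mono) auto
  moreover have "log 2 (4 :: real) = 2" using log_of_power_eq[of 4 2 2] by simp
  ultimately have L: "2 \<le> L" by simp
  have kn: "k \<le> n"
  proof -
    have "real k * (4 * L) \<le> real n" using k(3) L unfolding L_def[symmetric] by (simp add: field_simps)
    moreover have "real k * 1 \<le> real k * (4 * L)" using L by (intro mult_left_mono) auto
    ultimately show ?thesis by linarith
  qed
  have A: "2 * real k \<le> A" "2 \<le> A"
  proof -
    have "real k * 2 \<le> real k * (4 * L)" using L by (intro mult_left_mono) auto
    then show "2 * real k \<le> A" by (simp add: A_def)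
    then show "2 \<le> A" using k(1) by linarith
  qed
  have b: "1 \<le> b" "k * b \<le> n" using kn k(1) by (auto simp: b_def Suc_le_eq div_greater_zero_iff)
  \<comment> \<open>The remainder of the division is below \<open>k\<close>, hence below
    \<open>k * b + 1\<close>, so rounding loses at most a factor 2.\<close>
  have nb: "real n \<le> 2 * real k * real b"
  proof -
    have "n = k * b + n mod k" by (simp add: b_def)
    moreover have "n mod k < k" using k(1) by simp
    moreover have "k * 1 \<le> k * b" using b(1) by (rule mult_le_mono2)
    ultimately have "n \<le> 2 * k * b" by linarith
    then have "real n \<le> real (2 * k * b)" by (simp only: of_nat_le_iff)
    then show ?thesis by simp
  qed
  define \<epsilon> where "\<epsilon> = A ^ k / real n ^ d"
  have n0: "real n > 0" using k(2) by simp
  have "1 \<le> real (pcr_size \<pi>) * \<epsilon>"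
  proof (rule refutation_size_ge[OF k(1,2) \<pi> b d_def])
    \<comment> \<open>Since \<open>2 powr L\<close> is \<open>n\<close>, the bits contribute
      \<open>n ^ (4 * k)\<close>, more than the \<open>n ^ d\<close> in the denominator of
      \<open>\<epsilon>\<close>.\<close>
    have "2 powr A = (2 powr L) powr (4 * real k)" by (simp add: A_def powr_powr mult_ac)
    also have "2 powr L = real n" using n0 by (simp add: L_def)
    also have "real n powr (4 * real k) = real n ^ (4 * k)" using n0 powr_realpow[of "real n" "4 * k"] by simp
    finally have pA: "2 powr A = real n ^ (4 * k)" .
    have "real n ^ d \<le> real n ^ (4 * k)" using k by (intro power_increasing) (auto simp: d_def)
    then have "1 \<le> real n ^ (4 * k) / real n ^ d" using n0 by simp
    moreover have "2 ^ k \<le> A ^ k" using A by (intro power_mono) auto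
    ultimately have "2 ^ k * 1 \<le> A ^ k * (real n ^ (4 * k) / real n ^ d)"
      using A by (intro mult_mono) auto
    then show "2 ^ k \<le> \<epsilon> * 2 powr A" by (simp add: \<epsilon>_def pA)
    \<comment> \<open>From \<open>n \<le> 2 k b \<le> A b\<close> one gets
      \<open>n ^ d \<le> A ^ d * b ^ d\<close>. As \<open>d \<le> k - d\<close>, the power of
      \<open>A\<close> may be raised to \<open>k - d\<close>, and the factor \<open>A ^ d\<close>
      completes it to \<open>A ^ k\<close>.\<close>
    have "real n ^ d \<le> (2 * real k * real b) ^ d" using nb by (intro power_mono) auto
    also have "\<dots> = (2 * real k) ^ d * real b ^ d" by (rule power_mult_distrib)
    also have "\<dots> \<le> A ^ d * real b ^ d" using A by (intro mult_right_mono power_mono) auto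
    also have "\<dots> \<le> A ^ (k - d) * real b ^ d"
      using A by (intro mult_right_mono power_increasing) (auto simp: d_def)
    finally have "A ^ d * real n ^ d \<le> A ^ d * (A ^ (k - d) * real b ^ d)"
      using A by (intro mult_left_mono) auto
    also have "\<dots> = A ^ (d + (k - d)) * real b ^ d" by (simp add: power_add)
    also have "d + (k - d) = k" by (simp add: d_def)
    finally show "A ^ d \<le> \<epsilon> * real b ^ d" using n0 by (simp add: \<epsilon>_def field_simps)
  qed (use A in simp)
  then have "real n ^ d \<le> real (pcr_size \<pi>) * A ^ k" using n0 by (simp add: \<epsilon>_def field_simps)
  moreover have "0 < A ^ k" using A by simp
  ultimately have "real n ^ d / A ^ k \<le> real (pcr_size \<pi>)" by (simp add: pos_divide_le_eq)
  then show ?thesis by (simp add: d_eq A_def L_def)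
qed

theorem theorem4p9:
  fixes k :: "nat \<Rightarrow> nat"
  assumes "eventually (\<lambda>n. real (k n) \<le> real n / (4 * log 2 (real n))) sequentially"
  shows "(\<exists>C>0. eventually (\<lambda>n. 4 \<le> k n \<longrightarrow>
            (\<exists>\<pi> :: (erphp_var, 'a::field) pcr_poly list.
               pcr_refutation (erphp_vars (k n) n) (erphp (k n) n) \<pi> \<and>
               real (pcr_size \<pi>) \<le> C * (real (k n) ^ (k n + 1) * real n ^ k n))) sequentially)
       \<and> (\<exists>c>0. eventually (\<lambda>n. 4 \<le> k n \<longrightarrow>
            (\<forall>\<pi> :: (erphp_var, 'a) pcr_poly list.
               pcr_refutation (erphp_vars (k n) n) (erphp (k n) n) \<pi> \<longrightarrow>
               c * (real n ^ nat \<lceil>(real (k n) - 1) / 2\<rceil> / (4 * real (k n) * log 2 (real n)) ^ k n)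
                 \<le> real (pcr_size \<pi>))) sequentially)"
proof (intro conjI exI)
  \<comment> \<open>Both estimates hold from \<open>n = 4\<close> on, the lower one wherever the
    bound on \<open>k n\<close> holds; the constants are 336 and 1.\<close>
  have n4: "eventually (\<lambda>n :: nat. 4 \<le> n) sequentially" by (rule eventually_ge_at_top)
  show "eventually (\<lambda>n. 4 \<le> k n \<longrightarrow>
            (\<exists>\<pi> :: (erphp_var, 'a) pcr_poly list.
               pcr_refutation (erphp_vars (k n) n) (erphp (k n) n) \<pi> \<and>
               real (pcr_size \<pi>) \<le> 336 * (real (k n) ^ (k n + 1) * real n ^ k n))) sequentially"
    using n4
  proof eventually_elim
    case (elim n)
    show ?case
    proof
      assume "4 \<le> k n"
      then obtain \<pi> :: "(erphp_var, 'a) pcr_poly list"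
        where \<pi>: "pcr_refutation (erphp_vars (k n) n) (erphp (k n) n) \<pi>"
          "pcr_size \<pi> \<le> 336 * (k n ^ (k n + 1) * n ^ k n)"
        using erphp_refutation[of "k n" n, where 'a='a] elim by blast
      then have "real (pcr_size \<pi>) \<le> real (336 * (k n ^ (k n + 1) * n ^ k n))"
        by (simp only: of_nat_le_iff)
      then show "\<exists>\<pi> :: (erphp_var, 'a) pcr_poly list.
               pcr_refutation (erphp_vars (k n) n) (erphp (k n) n) \<pi> \<and>
               real (pcr_size \<pi>) \<le> 336 * (real (k n) ^ (k n + 1) * real n ^ k n)"
        using \<pi>(1) by auto
    qed
  qed
  show "eventually (\<lambda>n. 4 \<le> k n \<longrightarrow>
            (\<forall>\<pi> :: (erphp_var, 'a) pcr_poly list.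
               pcr_refutation (erphp_vars (k n) n) (erphp (k n) n) \<pi> \<longrightarrow>
               1 * (real n ^ nat \<lceil>(real (k n) - 1) / 2\<rceil> / (4 * real (k n) * log 2 (real n)) ^ k n)
                 \<le> real (pcr_size \<pi>))) sequentially"
    using n4 assms
  proof eventually_elim
    case (elim n)
    then show ?case using refutation_size_lower_bound[of "k n" n, where 'a='a] by simp
  qed
qed simp_all

end
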